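(* Let $f$ be an entire function which is not a polynomial of degree $0$ or $1$, and let $z_0\in\mathbb{C}$ with $f(z_0)=z_0$ and $f'(z_0)=1$. Let $m:=\min\{n\in\mathbb{N}:f^{(n+1)}(z_0)\neq0\}$, let $P_1,\dots,P_m$ be attracting petals for $f$ at $z_0$, let $k\in\{1,\dots,m\}$, and let $G_k:=\bigcup_{n\in\mathbb{N}_0}f^{-n}(P_k)$, with $\Phi_k:G_k\to\mathbb{C}$ the holomorphic function defined in the context. Then for comeager many functions $g\in H(\mathbb{C}\setminus\{z_0\})$, we have $$\omega(G_k,g,f)=H_{\Phi_k}(G_k).$$
   Context: $\mathbb{N}=\{1,2,\dots\}$, $\mathbb{N}_0=\mathbb{N}\cup\{0\}$; $f^n$ is the $n$-th iterate of $f$, $f^{(n)}$ its $n$-th derivative, and $f^{-n}(W)$ the preimage of $W$ under $f^n$. For open $W\subset\mathbb{C}$, $H(W)$ is the Fréchet space of holomorphic functions on $W$ with the topology of locally uniform convergence. A conformal map is a bijective holomorphic map. Attracting petals: by the Leau-Fatou flower theorem there exist $m$ pairwise disjoint simply connected domains $P_1,\dots,P_m\subset\mathbb{C}$, called attracting petals for $f$, with $f(P_k)\subset P_k$, $z_0\in\partial P_k$ and $f^n|_{P_k}\to z_0$ uniformly, such that for each $k$ there exist a simply connected domain $V_k\subset\mathbb{C}$ containing a right half-plane and a conformal map $\varphi_k:P_k\to V_k$ with $\varphi_k\circ f^n=\varphi_k+n$ on $P_k$ for all $n\in\mathbb{N}$. The petals in the claim are sets with these properties. The map $\varphi_k$ extends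 to a holomorphic function $\Phi_k:G_k\to\mathbb{C}$ with $\Phi_k|_{P_k}=\varphi_k$ and $\Phi_k\circ f^n=\Phi_k+n$ on $G_k$ for all $n\in\mathbb{N}$. Put $H_{\Phi_k}(G_k):=\{\psi\circ\Phi_k:\psi\in H(\Phi_k(G_k))\}$. $\omega(G_k,g,f)$ is the set of all functions $h:G_k\to\mathbb{C}$ for which there exists a strictly increasing sequence $(n_j)$ in $\mathbb{N}$ such that $(g\circ f^{n_j})$ converges to $h$ locally uniformly on $G_k$. A subset of a Baire space is comeager if it contains a dense $G_\delta$-set; "for comeager many $g$" means that the set of all such $g$ is comeager. *)

theory Defs
  imports "HOL-Complex_Analysis.Complex_Analysis"
begin

section \<open>Spaces of holomorphic functions\<close>

text \<open>
  Functions on \<open>W\<close> are represented by total functions with the value \<^const>\<open>undefined\<close>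
  outside \<open>W\<close>, so that equality of such functions is equality on \<open>W\<close>.
\<close>

definition holo_space :: "complex set \<Rightarrow> (complex \<Rightarrow> complex) set" where
  "holo_space W = {g. g holomorphic_on W \<and> g \<in> extensional W}"

definition locally_uniform_limit ::
    "complex set \<Rightarrow> ('i \<Rightarrow> complex \<Rightarrow> complex) \<Rightarrow> (complex \<Rightarrow> complex) \<Rightarrow> 'i filter \<Rightarrow> bool" where
  "locally_uniform_limit W f l F \<longleftrightarrow>
     (\<forall>z\<in>W. \<exists>U. open U \<and> z \<in> U \<and> uniform_limit (U \<inter> W) f l F)"

text \<open>
  The sets \<open>{h. \<forall>z\<in>K. dist (h z) (g z) < e}\<close> with \<open>K\<close> a compact subset of \<open>W\<close> form a
  neighbourhood base at \<open>g\<close>. For open \<open>W\<close>, convergence in this topology is locally uniform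
  convergence; see \<open>limitin_holo_topology\<close> below.
\<close>

definition holo_topology :: "complex set \<Rightarrow> (complex \<Rightarrow> complex) topology" where
  "holo_topology W = topology (\<lambda>U. U \<subseteq> holo_space W \<and>
     (\<forall>g\<in>U. \<exists>K e. compact K \<and> K \<subseteq> W \<and> e > 0 \<and>
        {h \<in> holo_space W. \<forall>z\<in>K. dist (h z) (g z) < e} \<subseteq> U))"

lemma openin_holo_topology:
  "openin (holo_topology W) U \<longleftrightarrow> U \<subseteq> holo_space W \<and>
     (\<forall>g\<in>U. \<exists>K e. compact K \<and> K \<subseteq> W \<and> e > 0 \<and>
        {h \<in> holo_space W. \<forall>z\<in>K. dist (h z) (g z) < e} \<subseteq> U)"
proof -
  let ?N = "\<lambda>g K e. {h \<in> holo_space W. \<forall>z\<in>K. dist (h z) (g z) < (e::real)}"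
  let ?P = "\<lambda>U g. \<exists>K e. compact K \<and> K \<subseteq> W \<and> e > 0 \<and> ?N g K e \<subseteq> U"
  have int: "?P (S \<inter> T) g" if S: "?P S g" and T: "?P T g" for S T g
  proof -
    obtain K e where K: "compact K" "K \<subseteq> W" "e > 0" "?N g K e \<subseteq> S" using S by blast
    obtain L d where L: "compact L" "L \<subseteq> W" "d > 0" "?N g L d \<subseteq> T" using T by blast
    have "?N g (K \<union> L) (min e d) \<subseteq> ?N g K e \<inter> ?N g L d" by auto
    then have "?N g (K \<union> L) (min e d) \<subseteq> S \<inter> T" using K(4) L(4) by blast
    moreover have "compact (K \<union> L)" "K \<union> L \<subseteq> W" "min e d > 0" using K L by auto
    ultimately show ?thesis by blast
  qed
  have un: "?P (\<Union>\<K>) g" if "S \<in> \<K>" "?P S g" for \<K> S g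
    using that by (meson Union_upper subset_trans)
  have "istopology (\<lambda>U. U \<subseteq> holo_space W \<and> (\<forall>g\<in>U. ?P U g))"
    unfolding istopology_def
  proof (intro conjI allI impI ballI)
    fix S T g assume "S \<subseteq> holo_space W \<and> (\<forall>g\<in>S. ?P S g)"
      "T \<subseteq> holo_space W \<and> (\<forall>g\<in>T. ?P T g)" "g \<in> S \<inter> T"
    then show "?P (S \<inter> T) g" by (intro int) auto
  next
    fix \<K> g assume a: "\<forall>S\<in>\<K>. S \<subseteq> holo_space W \<and> (\<forall>g\<in>S. ?P S g)" and "g \<in> \<Union>\<K>"
    then obtain S where "S \<in> \<K>" "g \<in> S" by blast
    with a show "?P (\<Union>\<K>) g" by (intro un) auto
  qed blast+
  then show ?thesis
    unfolding holo_topology_def by (simp add: topology_inverse')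
qed

lemma topspace_holo_topology [simp]: "topspace (holo_topology W) = holo_space W"
proof
  show "topspace (holo_topology W) \<subseteq> holo_space W"
    using openin_holo_topology openin_topspace by blast
  have "openin (holo_topology W) (holo_space W)"
    unfolding openin_holo_topology by (auto intro!: exI[of _ "{}"] exI[of _ "1::real"])
  then show "holo_space W \<subseteq> topspace (holo_topology W)"
    by (rule openin_subset)
qed

lemma locally_uniform_limit_iff_compact:
  assumes "open W"
  shows "locally_uniform_limit W f l F \<longleftrightarrow> (\<forall>K. compact K \<and> K \<subseteq> W \<longrightarrow> uniform_limit K f l F)"
proof (intro iffI allI impI)
  fix K assume loc: "locally_uniform_limit W f l F" and K: "compact K \<and> K \<subseteq> W"
  then obtain U where U: "\<And>z. z \<in> W \<Longrightarrow> open (U z) \<and> z \<in> U z \<and> uniform_limit (U z \<inter> W) f l F"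
    unfolding locally_uniform_limit_def by metis
  have "K \<subseteq> (\<Union>z\<in>K. U z)" using U K by blast
  then obtain C where C: "C \<subseteq> K" "finite C" "K \<subseteq> (\<Union>z\<in>C. U z)"
    using compactE_image[of K K U] U K by (metis subsetD)
  have "uniform_limit (\<Union>z\<in>C. U z \<inter> W) f l F"
    using C U K by (intro uniform_limit_on_UNION) auto
  then show "uniform_limit K f l F"
    by (rule uniform_limit_on_subset) (use C K in blast)
next
  assume comp: "\<forall>K. compact K \<and> K \<subseteq> W \<longrightarrow> uniform_limit K f l F"
  show "locally_uniform_limit W f l F"
    unfolding locally_uniform_limit_def
  proof
    fix z assume "z \<in> W"
    then obtain e where e: "e > 0" "cball z e \<subseteq> W"
      using assms open_contains_cball by blast
    then have "uniform_limit (cball z e) f l F" using comp by simp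
    then have "uniform_limit (ball z e \<inter> W) f l F"
      by (rule uniform_limit_on_subset) auto
    then show "\<exists>U. open U \<and> z \<in> U \<and> uniform_limit (U \<inter> W) f l F"
      using e by (intro exI[of _ "ball z e"]) auto
  qed
qed

lemma limitin_holo_topology:
  assumes W: "open W" and f: "\<And>i. f i \<in> holo_space W" and l: "l \<in> holo_space W"
  shows "limitin (holo_topology W) f l F \<longleftrightarrow> locally_uniform_limit W f l F"
  unfolding locally_uniform_limit_iff_compact[OF W]
proof (intro iffI allI impI)
  fix K assume lim: "limitin (holo_topology W) f l F" and K: "compact K \<and> K \<subseteq> W"
  show "uniform_limit K f l F"
    unfolding uniform_limit_iff
  proof (intro allI impI)
    fix e :: real assume e: "e > 0"
    define U where "U = {h \<in> holo_space W. \<exists>d<e. \<forall>z\<in>K. dist (h z) (l z) \<le> d}"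
    have "openin (holo_topology W) U"
      unfolding openin_holo_topology
    proof (intro conjI ballI)
      fix g assume "g \<in> U"
      then obtain d where d: "d < e" "\<forall>z\<in>K. dist (g z) (l z) \<le> d" unfolding U_def by blast
      have "{h \<in> holo_space W. \<forall>z\<in>K. dist (h z) (g z) < (e - d) / 2} \<subseteq> U"
      proof
        fix h assume h: "h \<in> {h \<in> holo_space W. \<forall>z\<in>K. dist (h z) (g z) < (e - d) / 2}"
        have "dist (h z) (l z) \<le> (e + d) / 2" if "z \<in> K" for z
        proof -
          have "dist (h z) (g z) < (e - d) / 2" "dist (g z) (l z) \<le> d" using h d that by auto
          moreover have "dist (h z) (l z) \<le> dist (h z) (g z) + dist (g z) (l z)"
            by (rule dist_triangle)
          ultimately show ?thesis by (simp add: field_simps)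
        qed
        moreover have "(e + d) / 2 < e" using d by simp
        ultimately show "h \<in> U" using h unfolding U_def by blast
      qed
      moreover have "(e - d) / 2 > 0" using d by simp
      ultimately show "\<exists>K e. compact K \<and> K \<subseteq> W \<and> e > 0 \<and>
          {h \<in> holo_space W. \<forall>z\<in>K. dist (h z) (g z) < e} \<subseteq> U"
        using K by blast
    qed (auto simp: U_def)
    moreover have "l \<in> U" using l e unfolding U_def by auto
    ultimately have "\<forall>\<^sub>F i in F. f i \<in> U" using lim unfolding limitin_def by blast
    then show "\<forall>\<^sub>F i in F. \<forall>z\<in>K. dist (f i z) (l z) < e"
      by (rule eventually_mono) (force simp: U_def)
  qed
next
  assume comp: "\<forall>K. compact K \<and> K \<subseteq> W \<longrightarrow> uniform_limit K f l F"
  show "limitin (holo_topology W) f l F"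
    unfolding limitin_def
  proof (intro conjI allI impI)
    fix U assume "openin (holo_topology W) U \<and> l \<in> U"
    then obtain K e where K: "compact K" "K \<subseteq> W" "e > 0"
        "{h \<in> holo_space W. \<forall>z\<in>K. dist (h z) (l z) < e} \<subseteq> U"
      unfolding openin_holo_topology by meson
    then have "\<forall>\<^sub>F i in F. \<forall>z\<in>K. dist (f i z) (l z) < e"
      using comp unfolding uniform_limit_iff by blast
    then show "\<forall>\<^sub>F i in F. f i \<in> U"
      by (rule eventually_mono) (use f K(4) in blast)
  qed (use l in simp)
qed

definition comeager_in :: "'a topology \<Rightarrow> 'a set \<Rightarrow> bool" where
  "comeager_in X A \<longleftrightarrow>
     A \<subseteq> topspace X \<and> (\<exists>D. gdelta_in X D \<and> X closure_of D = topspace X \<and> D \<subseteq> A)"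

section \<open>Attracting petals\<close>

definition simply_connected_domain :: "complex set \<Rightarrow> bool" where
  "simply_connected_domain S \<longleftrightarrow> S \<noteq> {} \<and> open S \<and> connected S \<and> simply_connected S"

definition conformal_map :: "(complex \<Rightarrow> complex) \<Rightarrow> complex set \<Rightarrow> complex set \<Rightarrow> bool" where
  "conformal_map \<phi> P V \<longleftrightarrow> \<phi> holomorphic_on P \<and> bij_betw \<phi> P V"

definition fatou_coordinate ::
    "(complex \<Rightarrow> complex) \<Rightarrow> complex set \<Rightarrow> complex set \<Rightarrow> (complex \<Rightarrow> complex) \<Rightarrow> bool" where
  "fatou_coordinate f P V \<phi> \<longleftrightarrow>
     simply_connected_domain V \<and> (\<exists>c::real. {w. c < Re w} \<subseteq> V) \<and> conformal_map \<phi> P V \<and>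
     (\<forall>n\<ge>1. \<forall>z\<in>P. \<phi> ((f ^^ n) z) = \<phi> z + of_nat n)"

definition attracting_petals ::
    "(complex \<Rightarrow> complex) \<Rightarrow> complex \<Rightarrow> nat \<Rightarrow> (nat \<Rightarrow> complex set) \<Rightarrow> bool" where
  "attracting_petals f z0 m P \<longleftrightarrow>
     disjoint_family_on P {1..m} \<and>
     (\<forall>k\<in>{1..m}. simply_connected_domain (P k) \<and> f ` P k \<subseteq> P k \<and> z0 \<in> frontier (P k) \<and>
        uniform_limit (P k) (\<lambda>n. f ^^ n) (\<lambda>_. z0) sequentially \<and>
        (\<exists>V \<phi>. fatou_coordinate f (P k) V \<phi>))"

definition petal_basin :: "(complex \<Rightarrow> complex) \<Rightarrow> complex set \<Rightarrow> complex set" where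
  "petal_basin f P = (\<Union>n. (f ^^ n) -` P)"

text \<open>
  The extension is unique: if \<open>(f ^^ n) z \<in> P\<close>, then \<open>\<Phi> z = \<phi> ((f ^^ n) z) - of_nat n\<close>.
\<close>

definition fatou_extension ::
    "(complex \<Rightarrow> complex) \<Rightarrow> complex set \<Rightarrow> (complex \<Rightarrow> complex) \<Rightarrow> (complex \<Rightarrow> complex) \<Rightarrow> bool" where
  "fatou_extension f P \<phi> \<Phi> \<longleftrightarrow>
     \<Phi> holomorphic_on petal_basin f P \<and> (\<forall>z\<in>P. \<Phi> z = \<phi> z) \<and>
     (\<forall>n\<ge>1. \<forall>z\<in>petal_basin f P. \<Phi> ((f ^^ n) z) = \<Phi> z + of_nat n)"

section \<open>Limit functions\<close>

definition omega_limit ::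
    "complex set \<Rightarrow> (complex \<Rightarrow> complex) \<Rightarrow> (complex \<Rightarrow> complex) \<Rightarrow> (complex \<Rightarrow> complex) set" where
  "omega_limit G g f = {h \<in> extensional G. \<exists>n::nat \<Rightarrow> nat. strict_mono n \<and> (\<forall>j. n j \<ge> 1) \<and>
     locally_uniform_limit G (\<lambda>j. g \<circ> (f ^^ n j)) h sequentially}"

definition composition_space ::
    "(complex \<Rightarrow> complex) \<Rightarrow> complex set \<Rightarrow> (complex \<Rightarrow> complex) set" where
  "composition_space \<Phi> G = {restrict (\<psi> \<circ> \<Phi>) G | \<psi>. \<psi> \<in> holo_space (\<Phi> ` G)}"

end

theory Submission
  imports Defs
begin

text \<open>
  Everything is read in the Fatou coordinate. Let \<open>\<theta>\<close> be the inverse of \<open>\<phi>\<close>. If \<open>(f ^^ n) z\<close> lies in the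
  petal, then \<open>(f ^^ n) z = \<theta> (\<Phi> z + n)\<close>, so on compact subsets of the basin \<open>G\<close>, for large \<open>n\<close>,
  the function \<open>g \<circ> f ^^ n\<close> is the composition of \<open>\<Phi>\<close> with \<open>w \<mapsto> g (\<theta> (w + n))\<close>. The limit functions
  of \<open>g \<circ> f ^^ n\<close> on \<open>G\<close> therefore correspond to the limit functions of the translates of \<open>g \<circ> \<theta>\<close> on
  \<open>\<Phi> ` G\<close>. For every \<open>g\<close> such a limit is holomorphic there, which is the inclusion
  \<open>omega_limit_subset\<close>.

  For the other inclusion one needs \<open>\<Phi> ` G = \<complex>\<close> (\<open>\<Phi>_surj\<close>): were \<open>\<Phi> ` G\<close> punctured at some point \<open>p\<close>,
  the translates, which are eventually defined on a whole disc around \<open>p\<close>, could only converge to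
  functions that extend to \<open>p\<close>. By the little Picard theorem, all iterates of \<open>f\<close> omit at most one
  and the same value \<open>a\<close>. A point \<open>w\<close> has infinitely many distinct translates \<open>\<theta> (w + n)\<close>, one of
  them differs from \<open>a\<close>, and an \<open>n\<close>-th preimage of it is mapped to \<open>w\<close> by \<open>\<Phi>\<close>.

  It remains to find \<open>g\<close> whose translates approximate every polynomial \<open>q\<close> from a countable dense
  set on every disc \<open>cball 0 s\<close>. For fixed \<open>q\<close> and \<open>s\<close> these \<open>g\<close> form an open set, so by Baire's theorem
  density suffices (\<open>dense_universal_set\<close>). Here \<open>g0\<close> has to be changed near the small set
  \<open>\<theta> (cball 0 s + n)\<close>, which tends to \<open>z0\<close>, and almost preserved on a compact set away from \<open>z0\<close>. Since
  \<open>\<theta>\<close> is injective on a disc of radius about \<open>n\<close> around \<open>n\<close>, a weak form of the Koebe distortion theorem,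
  derived from Bloch's theorem, shows that \<open>\<theta>\<close> is almost an affine map \<open>w \<mapsto> a + b * w\<close> on the disc
  \<open>cball 0 s + n\<close>, and that the image is small in comparison with its distance from \<open>z0\<close>. Hence
  \<open>(a - z0) / (z - z0)\<close> is close to \<open>1\<close> on the image and close to \<open>0\<close> far from \<open>z0\<close>. Iterating a
  polynomial with superattracting fixed points \<open>0\<close> and \<open>1\<close> on this quotient yields a function
  holomorphic off \<open>z0\<close> that is nearly \<open>1\<close> on the image and nearly \<open>0\<close> far away, and with it one
  interpolates between \<open>z \<mapsto> q ((z - a) / b)\<close> and \<open>g0\<close> (\<open>prescribe_on_univalent_disc\<close>). Because
  \<open>\<theta>\<close> is almost affine, this replaces an appeal to Runge's theorem.
\<close>

section \<open>Distortion of univalent functions\<close>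

text \<open>
  A weak form of the Koebe one-quarter theorem. A logarithm of \<open>S - c\<close> cannot take two values that
  differ by \<open>2 * pi * \<i>\<close>, since \<open>S\<close> is injective. So its image contains no disc of radius larger
  than \<open>pi\<close>, and Bloch's theorem bounds its derivative.
\<close>

lemma univalent_deriv_bound:
  assumes holS: "S holomorphic_on ball p M" and inj: "inj_on S (ball p M)" and M: "0 < M"
    and c: "c \<notin> S ` ball p M"
  shows "M * norm (deriv S p) \<le> 12 * pi * norm (S p - c)"
proof -
  have p: "p \<in> ball p M" using M by simp
  have "simply_connected (ball p M)" by (simp add: convex_imp_simply_connected)
  moreover have "(\<lambda>w. S w - c) holomorphic_on ball p M" by (intro holomorphic_intros holS)
  moreover have "\<forall>w\<in>ball p M. S w - c \<noteq> 0" using c by (metis eq_iff_diff_eq_0 image_eqI)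
  ultimately obtain h where holh: "h holomorphic_on ball p M" and h: "\<forall>w\<in>ball p M. S w - c = exp (h w)"
    using simply_connected_eq_holomorphic_log[of "ball p M"] by (metis (no_types, lifting) open_ball)
  have dh: "(h has_field_derivative deriv h p) (at p)"
    using holh p holomorphic_derivI open_ball by blast
  have "((\<lambda>w. exp (h w)) has_field_derivative exp (h p) * deriv h p) (at p)"
    by (rule DERIV_fun_exp[OF dh])
  then have "((\<lambda>w. S w - c) has_field_derivative exp (h p) * deriv h p) (at p)"
    by (rule has_field_derivative_transform_within_open[OF _ open_ball p]) (use h in auto)
  then have "((\<lambda>w. S w - c + c) has_field_derivative exp (h p) * deriv h p + 0) (at p)"
    by (intro derivative_intros)
  then have dS: "deriv S p = (S p - c) * deriv h p"
    using h p by (simp add: DERIV_imp_deriv)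
  have "M * norm (deriv h p) / 12 \<le> pi"
  proof (rule ccontr)
    assume "\<not> ?thesis"
    then have r: "pi < M * norm (deriv h p) / 12" by simp
    obtain b where b: "ball b (M * norm (deriv h p) / 12) \<subseteq> h ` ball p M"
      using Bloch[OF holh M order_refl] by blast
    \<comment> \<open>A disc of radius larger than \<open>pi\<close> contains two points with the same exponential.\<close>
    have "b + \<i> * pi \<in> h ` ball p M" "b - \<i> * pi \<in> h ` ball p M"
      using b r by (auto simp: dist_norm norm_mult intro!: subsetD[OF b])
    then obtain x y where xy: "x \<in> ball p M" "y \<in> ball p M" "h x = b + \<i> * pi" "h y = b - \<i> * pi"
      by (metis imageE)
    have "exp (h x) = exp (h y)" using xy by (simp add: exp_add exp_diff)
    then have "S x = S y" using h xy by (metis add_diff_cancel_right' diff_add_cancel)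
    then have "x = y" using inj xy by (meson inj_onD)
    then show False using xy by simp
  qed
  then have "norm (S p - c) * (M * norm (deriv h p)) \<le> norm (S p - c) * (12 * pi)"
    by (intro mult_left_mono) auto
  then show ?thesis using dS by (simp add: norm_mult mult_ac)
qed

text \<open>
  A weak form of the Koebe distortion theorem. Let \<open>k\<close> be the difference quotient of \<open>S\<close> at \<open>0\<close> and \<open>l\<close> a
  logarithm of it. On the circle of radius \<open>M / 2\<close>, \<open>univalent_deriv_bound\<close> with the omitted value
  \<open>S 0\<close> bounds \<open>deriv l w = deriv S w / (S w - S 0) - 1 / w\<close>. The maximum principle extends the bound
  to the disc, so that \<open>k\<close> is nearly constant near \<open>0\<close>.
\<close>

lemma univalent_almost_affine:
  assumes holS: "S holomorphic_on ball 0 M" and inj: "inj_on S (ball 0 M)"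
    and w: "200 * norm w \<le> M" and M: "0 < M"
  shows "norm (S w - S 0 - deriv S 0 * w) \<le> 150 * norm w / M * (norm (deriv S 0) * norm w)"
proof -
  define k where "k = (\<lambda>w. if w = 0 then deriv S 0 else (S w - S 0) / w)"
  have 0: "0 \<in> ball 0 M" using M by simp
  have dS0: "deriv S 0 \<noteq> 0" by (rule holomorphic_injective_imp_regular[OF holS open_ball inj 0])
  have holg: "(\<lambda>w. S w - S 0) holomorphic_on ball 0 M" by (intro holomorphic_intros holS)
  have diffS: "(S has_field_derivative deriv S x) (at x)" if "x \<in> ball 0 M" for x
    using holS that holomorphic_derivI open_ball by blast
  have dg: "deriv (\<lambda>w. S w - S 0) 0 = deriv S 0"
    by (rule DERIV_imp_deriv) (auto intro!: derivative_eq_intros diffS 0)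
  have holk: "k holomorphic_on ball 0 M"
    by (rule pole_theorem_open_0[OF holg open_ball, of 0]) (auto simp: k_def dg)
  have nz: "k x \<noteq> 0" if "x \<in> ball 0 M" for x
    using dS0 that inj_onD[OF inj, of x 0] 0 by (auto simp: k_def)
  obtain l where holl: "l holomorphic_on ball 0 M" and l: "\<And>x. x \<in> ball 0 M \<Longrightarrow> k x = exp (l x)"
    using simply_connected_eq_holomorphic_log[of "ball (0::complex) M"] holk nz
    by (metis (no_types, lifting) open_ball convex_imp_simply_connected convex_ball)
  have dl: "(l has_field_derivative deriv l x) (at x)" if "x \<in> ball 0 M" for x
    using holl that holomorphic_derivI open_ball by blast
  \<comment> \<open>The logarithmic derivative of the difference quotient, cleared of denominators.\<close>
  have eq: "x * deriv l x * (S x - S 0) = deriv S x * x - (S x - S 0)" if x: "x \<in> ball 0 M" for x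
  proof -
    have e: "S y = S 0 + y * exp (l y)" if "y \<in> ball 0 M" for y
      using l[OF that] by (auto simp: k_def field_simps split: if_splits)
    have "((\<lambda>y. S 0 + y * exp (l y)) has_field_derivative exp (l x) + x * (exp (l x) * deriv l x)) (at x)"
      by (auto intro!: derivative_eq_intros dl[OF x])
    then have "(S has_field_derivative exp (l x) + x * (exp (l x) * deriv l x)) (at x)"
      by (rule has_field_derivative_transform_within_open[OF _ open_ball x]) (use e in auto)
    then have "deriv S x = exp (l x) + x * (exp (l x) * deriv l x)" by (rule DERIV_imp_deriv)
    moreover have "S x - S 0 = x * exp (l x)" using e[OF x] by simp
    ultimately show ?thesis by (simp add: algebra_simps)
  qed
  have bd: "norm (deriv l x) \<le> 100 / M" if x: "x \<in> sphere 0 (M/2)" for x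
  proof -
    have nx: "norm x = M / 2" "x \<noteq> 0" using x M by auto
    have sub: "ball x (M/2) \<subseteq> ball 0 M"
      using nx by (simp add: ball_subset_ball_iff dist_norm)
    have "S 0 \<notin> S ` ball x (M/2)"
    proof
      assume "S 0 \<in> S ` ball x (M/2)"
      then obtain y where "y \<in> ball x (M/2)" "S y = S 0" by auto
      moreover then have "y = 0" using inj sub 0 by (metis inj_onD subsetD)
      ultimately show False using nx by simp
    qed
    then have "M / 2 * norm (deriv S x) \<le> 12 * pi * norm (S x - S 0)"
      using holS inj sub M by (intro univalent_deriv_bound) (auto intro: holomorphic_on_subset inj_on_subset)
    also have "\<dots> \<le> 48 * norm (S x - S 0)"
      using pi_less_4 by (intro mult_right_mono) auto
    finally have 1: "norm (deriv S x * x) \<le> 48 * norm (S x - S 0)"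
      by (simp add: norm_mult nx mult_ac)
    have xM: "x \<in> ball 0 M" using nx M by simp
    have n0: "S x - S 0 \<noteq> 0" using nx nz[OF xM] by (auto simp: k_def)
    have "norm (x * deriv l x * (S x - S 0)) \<le> norm (deriv S x * x) + norm (S x - S 0)"
      unfolding eq[OF xM] by (rule norm_triangle_ineq4)
    then have "(M / 2 * norm (deriv l x)) * norm (S x - S 0) \<le> 49 * norm (S x - S 0)"
      using 1 by (simp add: norm_mult nx)
    then have "M / 2 * norm (deriv l x) \<le> 49" using n0 by simp
    then show ?thesis using M by (simp add: field_simps)
  qed
  have bd2: "norm (deriv l x) \<le> 100 / M" if x: "x \<in> cball 0 (M/2)" for x
  proof (rule maximum_modulus_frontier[of "deriv l" "cball 0 (M/2)"])
    have h: "deriv l holomorphic_on ball 0 M" by (intro holomorphic_deriv holl) auto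
    have s: "cball 0 (M/2) \<subseteq> ball (0::complex) M" using M by auto
    show "deriv l holomorphic_on interior (cball 0 (M / 2))"
      using h s by (meson holomorphic_on_subset interior_subset subset_trans)
    show "continuous_on (closure (cball 0 (M / 2))) (deriv l)"
      using h s by (simp add: holomorphic_on_imp_continuous_on holomorphic_on_subset)
    show "bounded (cball (0::complex) (M/2))" by simp
    show "norm (deriv l z) \<le> 100 / M" if "z \<in> frontier (cball 0 (M / 2))" for z
      using bd that by simp
  qed (rule x)
  have ww: "w \<in> cball 0 (M/2)" "w \<in> ball 0 M" using w M norm_ge_zero[of w] unfolding mem_cball mem_ball dist_0_norm by linarith+
  have "norm (l w - l 0) \<le> 100 / M * norm (w - 0)"
  proof (rule field_differentiable_bound[OF convex_cball])
    show "(l has_field_derivative deriv l z) (at z within cball 0 (M / 2))" if "z \<in> cball 0 (M / 2)" for z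
      using that M by (intro DERIV_subset[OF dl]) auto
  qed (use bd2 ww M in auto)
  \<comment> \<open>By the bound on \<open>w\<close> this is at most \<open>1/2\<close>, where \<open>exp t - 1\<close> is at most \<open>3/2 * t\<close> in norm.\<close>
  then have lw: "norm (l w - l 0) \<le> 100 * norm w / M" by simp
  moreover have "100 * norm w / M \<le> 1/2" using w M by (simp add: field_simps)
  ultimately have "norm (exp (l w - l 0) - 1) \<le> 3/2 * norm (l w - l 0)"
    by (intro norm_exp_bounds(2)) linarith
  also have "\<dots> \<le> 150 * norm w / M" using lw by simp
  finally have ex: "norm (exp (l w - l 0) - 1) \<le> 150 * norm w / M" .
  have "k w = deriv S 0 * exp (l w - l 0)"
    using l[OF 0] l[OF ww(2)] by (simp add: k_def exp_diff)
  moreover have "S w - S 0 = w * k w" by (simp add: k_def)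
  ultimately have "S w - S 0 - deriv S 0 * w = (exp (l w - l 0) - 1) * (deriv S 0 * w)"
    by (simp add: algebra_simps)
  then have "norm (S w - S 0 - deriv S 0 * w) = norm (exp (l w - l 0) - 1) * (norm (deriv S 0) * norm w)"
    by (simp add: norm_mult)
  also have "\<dots> \<le> 150 * norm w / M * (norm (deriv S 0) * norm w)"
    using ex by (intro mult_right_mono) auto
  finally show ?thesis .
qed

section \<open>Separation and approximation off a point\<close>

text \<open>
  The points \<open>0\<close> and \<open>1\<close> are fixed points at which the derivative of this polynomial vanishes, so
  its iterates converge to a step function near these points.
\<close>

definition step_poly :: "complex \<Rightarrow> complex" where
  "step_poly x = x\<^sup>2 * (3 - 2 * x)"

lemma step_poly_iterate_near_0:
  assumes "norm x \<le> 1/4" shows "norm ((step_poly ^^ l) x) \<le> (7/8) ^ l / 4"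
proof (induction l)
  case (Suc l)
  define y where "y = (step_poly ^^ l) x"
  have "(7/8::real) ^ l \<le> 1" by (simp add: power_le_one)
  then have y: "norm y \<le> 1/4" using Suc y_def by simp
  have "norm (3 - 2 * y) \<le> 3 + 2 * norm y"
    using norm_triangle_ineq4[of 3 "2*y"] by (simp add: norm_mult)
  then have "norm y * norm (3 - 2 * y) \<le> 1/4 * (7/2)"
    using y by (intro mult_mono) auto
  then have "norm y * (norm y * norm (3 - 2 * y)) \<le> norm y * (7/8)"
    by (intro mult_left_mono) auto
  then have "norm (step_poly y) \<le> norm y * (7/8)"
    by (simp add: step_poly_def norm_mult power2_eq_square mult_ac)
  then show ?case using Suc by (simp add: y_def)
qed (use assms in simp)

lemma step_poly_iterate_symmetric: "(step_poly ^^ l) (1 - x) = 1 - (step_poly ^^ l) x"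
proof (induction l)
  case (Suc l)
  have "step_poly (1 - y) = 1 - step_poly y" for y
    unfolding step_poly_def by algebra
  then show ?case using Suc by simp
qed simp

lemma step_poly_iterate_near_1:
  assumes "norm (x - 1) \<le> 1/4" shows "norm ((step_poly ^^ l) x - 1) \<le> (7/8) ^ l / 4"
  using step_poly_iterate_near_0[of "1 - x" l] assms
  by (simp add: step_poly_iterate_symmetric norm_minus_commute)

lemma holomorphic_step_poly_iterate: "(step_poly ^^ l) holomorphic_on UNIV"
proof (induction l)
  case (Suc l)
  have "step_poly holomorphic_on UNIV" unfolding step_poly_def by (intro holomorphic_intros)
  then have "step_poly \<circ> (step_poly ^^ l) holomorphic_on UNIV"
    using Suc by (meson holomorphic_on_compose holomorphic_on_subset subset_UNIV)
  then show ?case by (simp only: funpow.simps)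
qed (simp add: id_def)

text \<open>
  On \<open>S ` cball 0 s\<close> the inverse of \<open>S\<close> is almost \<open>(z - a) / b\<close>, so the new function has to be close to
  \<open>q ((z - a) / b)\<close> there and close to \<open>g0\<close> on \<open>L\<close>. An iterate of \<^const>\<open>step_poly\<close> at
  \<open>(a - z0) / (z - z0)\<close> switches between the two. The bound \<open>1000 * s \<le> M\<close> keeps this quotient within
  \<open>1/4\<close> of \<open>1\<close> on \<open>S ` cball 0 s\<close>, and \<open>far\<close> keeps it within \<open>1/4\<close> of \<open>0\<close> on \<open>L\<close>.
\<close>

lemma prescribe_on_univalent_disc:
  fixes g0 q :: "complex \<Rightarrow> complex"
  assumes holS: "S holomorphic_on ball 0 M" and inj: "inj_on S (ball 0 M)" and z0: "z0 \<notin> S ` ball 0 M"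
    and M: "1000 * s \<le> M" "0 < M" and s: "0 \<le> s"
    and g0: "g0 holomorphic_on - {z0}" and q: "q holomorphic_on UNIV"
    and L: "compact L" "L \<subseteq> - {z0}" and far: "\<And>z. z \<in> L \<Longrightarrow> 4 * norm (S 0 - z0) \<le> norm (z - z0)"
    and e: "0 < e"
    and q_var: "\<And>w v. norm w \<le> s \<Longrightarrow> norm (v - w) \<le> 150 * s\<^sup>2 / M \<Longrightarrow> norm (q v - q w) < e"
  shows "\<exists>g\<in>holo_space (- {z0}). (\<forall>z\<in>L. dist (g z) (g0 z) < e) \<and>
           (\<forall>w\<in>cball 0 s. norm (g (S w) - q w) < 2 * e)"
proof -
  define a where "a = S 0"
  define b where "b = deriv S 0"
  have sM: "cball 0 s \<subseteq> ball (0::complex) M" using M s by auto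
  have b0: "b \<noteq> 0"
    unfolding b_def by (rule holomorphic_injective_imp_regular[OF holS open_ball inj]) (use M in auto)
  have ball0: "(0::complex) \<in> ball 0 M" using M by simp
  have az0: "a \<noteq> z0" using z0 ball0 by (auto simp: a_def)
  have "M * norm b \<le> 12 * pi * norm (a - z0)"
    unfolding a_def b_def by (rule univalent_deriv_bound[OF holS inj M(2) z0])
  also have "\<dots> \<le> 48 * norm (a - z0)"
    using pi_less_4 by (intro mult_right_mono) auto
  finally have bM: "M * norm b \<le> 48 * norm (a - z0)" .
  have affine: "norm (S w - a - b * w) \<le> 150 * norm w / M * (norm b * norm w)" if "w \<in> cball 0 s" for w
  proof -
    have "200 * norm w \<le> M" using that M s by simp
    then show ?thesis unfolding a_def b_def by (rule univalent_almost_affine[OF holS inj _ M(2)])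
  qed
  have near1: "norm ((S w - a) / b - w) \<le> 150 * s\<^sup>2 / M" if w: "w \<in> cball 0 s" for w
  proof -
    have "norm ((S w - a) / b - w) = norm (S w - a - b * w) / norm b"
      using b0 by (simp add: field_simps flip: norm_divide)
    also have "\<dots> \<le> 150 * norm w / M * (norm b * norm w) / norm b"
      using affine[OF w] by (intro divide_right_mono) auto
    also have "\<dots> = 150 * (norm w)\<^sup>2 / M" using b0 by (simp add: power2_eq_square)
    also have "\<dots> \<le> 150 * s\<^sup>2 / M"
      using w M by (intro divide_right_mono mult_left_mono power_mono) auto
    finally show ?thesis .
  qed
  have near2: "norm ((a - z0) / (S w - z0) - 1) \<le> 1 / 4" if w: "w \<in> cball 0 s" for w
  proof -
    \<comment> \<open>The image of the disc lies in a disc around \<open>a\<close> of radius at most a tenth of the distance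
      from \<open>a\<close> to the omitted value.\<close>
    have "150 * norm w / M \<le> 1" using w M s by (simp add: field_simps)
    then have "150 * norm w / M * (norm b * norm w) \<le> 1 * (norm b * norm w)"
      by (intro mult_right_mono) auto
    then have "norm (S w - a - b * w) \<le> norm b * norm w" using affine[OF w] by simp
    then have "norm (S w - a) \<le> 2 * (norm b * norm w)"
      using norm_triangle_ineq[of "S w - a - b * w" "b * w"] by (simp add: norm_mult)
    also have "\<dots> \<le> 2 * (norm b * (M / 1000))"
      using w M by (intro mult_left_mono) auto
    also have "\<dots> = M * norm b / 500" by simp
    also have "\<dots> \<le> norm (a - z0) / 10" using bM norm_ge_zero[of "a - z0"] by linarith
    finally have 1: "norm (S w - a) \<le> norm (a - z0) / 10" .
    then have 2: "norm (S w - z0) \<ge> 9 / 10 * norm (a - z0)"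
      using norm_triangle_ineq[of "S w - z0" "a - S w"] norm_minus_commute[of "S w" a] by simp
    have nz: "S w - z0 \<noteq> 0" using w sM z0 by (metis eq_iff_diff_eq_0 image_eqI subsetD)
    have "(a - z0) / (S w - z0) - 1 = (a - S w) / (S w - z0)" using nz by (simp add: field_simps)
    then have "norm ((a - z0) / (S w - z0) - 1) = norm (S w - a) / norm (S w - z0)"
      by (simp add: norm_divide norm_minus_commute)
    also have "\<dots> \<le> 1 / 4"
      using 1 2 nz norm_ge_zero[of "a - z0"] by (simp add: divide_le_eq del: norm_ge_zero)
    finally show ?thesis .
  qed
  define K where "K = L \<union> S ` cball 0 s"
  have contS: "continuous_on (cball 0 s) S"
    using holS sM holomorphic_on_imp_continuous_on holomorphic_on_subset by blast
  have K: "compact K" "K \<subseteq> - {z0}"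
    using L z0 sM by (auto simp: K_def intro!: compact_Un compact_continuous_image contS)
  define d where "d z = q ((z - a) / b) - g0 z" for z
  have holq: "(\<lambda>z. q ((z - a) / b)) holomorphic_on - {z0}"
    using b0 by (intro holomorphic_on_compose_gen[OF _ q, unfolded o_def] holomorphic_intros) auto
  have hold: "d holomorphic_on - {z0}"
    unfolding d_def by (intro holomorphic_intros holq g0)
  then have "bounded (d ` K)"
    using K by (intro compact_imp_bounded compact_continuous_image holomorphic_on_imp_continuous_on)
      (auto intro: holomorphic_on_subset)
  then obtain B where B: "0 < B" "\<And>z. z \<in> K \<Longrightarrow> norm (d z) \<le> B" by (auto simp: bounded_pos)
  obtain l where l: "(7/8::real) ^ l < e / B"
    using real_arch_pow_inv[of "e/B" "7/8"] e B by auto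
  have small: "(7/8) ^ l / 4 * norm (d z) < e" if "z \<in> K" for z
  proof -
    have "(7/8) ^ l / 4 * norm (d z) \<le> (7/8) ^ l * B"
      using B that by (intro mult_mono) auto
    also have "\<dots> < e" using l B by (simp add: field_simps)
    finally show ?thesis .
  qed
  define \<sigma> where "\<sigma> z = (step_poly ^^ l) ((a - z0) / (z - z0))" for z
  have "\<sigma> holomorphic_on - {z0}"
    unfolding \<sigma>_def
    by (intro holomorphic_on_compose_gen[OF _ holomorphic_step_poly_iterate, unfolded o_def] holomorphic_intros) auto
  then have holg: "(\<lambda>z. g0 z + \<sigma> z * d z) holomorphic_on - {z0}"
    by (intro holomorphic_intros g0 hold)
  define g where "g = restrict (\<lambda>z. g0 z + \<sigma> z * d z) (- {z0})"
  have geq: "g z = g0 z + \<sigma> z * d z" if "z \<in> K" for z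
    using that K by (auto simp: g_def)
  show ?thesis
  proof (intro bexI[of _ g] conjI ballI)
    show "g \<in> holo_space (- {z0})"
      unfolding holo_space_def g_def using holomorphic_transform[OF holg] by auto
  next
    fix z assume z: "z \<in> L"
    then have zK: "z \<in> K" by (simp add: K_def)
    have "norm ((a - z0) / (z - z0)) \<le> 1 / 4"
      using far[OF z] L z by (auto simp: a_def norm_divide divide_le_eq)
    then have "norm (\<sigma> z) \<le> (7/8) ^ l / 4" unfolding \<sigma>_def by (rule step_poly_iterate_near_0)
    then have "norm (\<sigma> z * d z) \<le> (7/8) ^ l / 4 * norm (d z)"
      unfolding norm_mult by (rule mult_right_mono) simp
    then show "dist (g z) (g0 z) < e" using small[OF zK] by (simp add: geq[OF zK] dist_norm)
  next
    fix w :: complex assume w: "w \<in> cball 0 s"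
    then have zK: "S w \<in> K" by (simp add: K_def)
    have "norm (\<sigma> (S w) - 1) \<le> (7/8) ^ l / 4"
      unfolding \<sigma>_def by (rule step_poly_iterate_near_1[OF near2[OF w]])
    then have "norm ((\<sigma> (S w) - 1) * d (S w)) \<le> (7/8) ^ l / 4 * norm (d (S w))"
      unfolding norm_mult by (rule mult_right_mono) simp
    then have 1: "norm ((\<sigma> (S w) - 1) * d (S w)) < e" using small[OF zK] by linarith
    have 2: "norm (q ((S w - a) / b) - q w) < e" using q_var near1[OF w] w by simp
    have eq: "g (S w) - q w = (\<sigma> (S w) - 1) * d (S w) + (q ((S w - a) / b) - q w)"
      by (simp add: geq[OF zK] d_def algebra_simps)
    then show "norm (g (S w) - q w) < 2 * e"
      unfolding eq
      using 1 2 norm_triangle_ineq[of "(\<sigma> (S w) - 1) * d (S w)" "q ((S w - a) / b) - q w"] by linarith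
  qed
qed

section \<open>Baire category in spaces of holomorphic functions\<close>

text \<open>
  Density can be tested on the basic neighbourhoods. The functions within some uniform distance
  \<open>d < e\<close> of \<open>g\<close> on \<open>K\<close> form an open set inside such a neighbourhood, for which no maximum over \<open>K\<close>
  has to be attained.
\<close>

lemma dense_in_holo_topology_iff:
  assumes "D \<subseteq> holo_space W"
  shows "holo_topology W closure_of D = holo_space W \<longleftrightarrow>
    (\<forall>g\<in>holo_space W. \<forall>K e. compact K \<longrightarrow> K \<subseteq> W \<longrightarrow> e > 0 \<longrightarrow>
       (\<exists>h\<in>D. \<forall>z\<in>K. dist (h z) (g z) < e))" (is "_ \<longleftrightarrow> ?R")
proof
  assume cl: "holo_topology W closure_of D = holo_space W"
  show ?R
  proof (intro ballI allI impI)
    fix g K and e :: real assume g: "g \<in> holo_space W" and K: "compact K" "K \<subseteq> W" and e: "e > 0"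
    define U where "U = {h \<in> holo_space W. \<exists>d<e. \<forall>z\<in>K. dist (h z) (g z) \<le> d}"
    have "openin (holo_topology W) U"
      unfolding openin_holo_topology
    proof (intro conjI ballI)
      fix u assume "u \<in> U"
      then obtain d where d: "d < e" "\<forall>z\<in>K. dist (u z) (g z) \<le> d" unfolding U_def by blast
      have "{h \<in> holo_space W. \<forall>z\<in>K. dist (h z) (u z) < (e - d) / 2} \<subseteq> U"
      proof
        fix h assume h: "h \<in> {h \<in> holo_space W. \<forall>z\<in>K. dist (h z) (u z) < (e - d) / 2}"
        have "dist (h z) (g z) \<le> (e + d) / 2" if "z \<in> K" for z
        proof -
          have "dist (h z) (u z) < (e - d) / 2" "dist (u z) (g z) \<le> d" using h d that by auto
          then show ?thesis using dist_triangle[of "h z" "g z" "u z"] by (simp add: field_simps)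
        qed
        moreover have "(e + d) / 2 < e" using d by simp
        ultimately show "h \<in> U" using h unfolding U_def by blast
      qed
      moreover have "(e - d) / 2 > 0" using d by simp
      ultimately show "\<exists>K e. compact K \<and> K \<subseteq> W \<and> e > 0 \<and>
          {h \<in> holo_space W. \<forall>z\<in>K. dist (h z) (u z) < e} \<subseteq> U"
        using K by blast
    qed (auto simp: U_def)
    moreover have "g \<in> U" using g e unfolding U_def by auto
    moreover have "g \<in> holo_topology W closure_of D" using g cl by simp
    ultimately obtain h where "h \<in> D" "h \<in> U"
      unfolding in_closure_of by blast
    then show "\<exists>h\<in>D. \<forall>z\<in>K. dist (h z) (g z) < e" unfolding U_def by force
  qed
next
  assume R: ?R
  show "holo_topology W closure_of D = holo_space W"
  proof
    show "holo_topology W closure_of D \<subseteq> holo_space W"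
      using closure_of_subset_topspace[of "holo_topology W" D] by simp
    show "holo_space W \<subseteq> holo_topology W closure_of D"
    proof
      fix g assume g: "g \<in> holo_space W"
      have "\<exists>y\<in>D. y \<in> T" if T: "g \<in> T" "openin (holo_topology W) T" for T
      proof -
        obtain K e where K: "compact K" "K \<subseteq> W" "e > 0"
          "{h \<in> holo_space W. \<forall>z\<in>K. dist (h z) (g z) < e} \<subseteq> T"
          using T unfolding openin_holo_topology by meson
        have "\<exists>h\<in>D. \<forall>z\<in>K. dist (h z) (g z) < e"
          using bspec[OF R g] K(1-3) by simp
        then obtain h where "h \<in> D" "\<forall>z\<in>K. dist (h z) (g z) < e" by blast
        then show ?thesis using K(4) assms by blast
      qed
      then show "g \<in> holo_topology W closure_of D" using g by (auto simp: in_closure_of)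
    qed
  qed
qed

text \<open>
  The usual nested construction: the functions \<open>G n\<close>, compact sets \<open>L n\<close> exhausting \<open>W\<close> and radii \<open>E n\<close>
  are chosen such that each neighbourhood lies well inside the preceding one and inside the next
  open set. The \<open>G n\<close> are uniformly Cauchy on compact sets, and their limit is holomorphic by
  Weierstrass' theorem.
\<close>

theorem Baire_holo_topology:
  fixes U :: "nat \<Rightarrow> (complex \<Rightarrow> complex) set"
  assumes W: "open W" and op: "\<And>n. openin (holo_topology W) (U n)"
    and dense: "\<And>n. holo_topology W closure_of U n = holo_space W"
  shows "holo_topology W closure_of (\<Inter>n. U n) = holo_space W"
proof -
  let ?N = "\<lambda>g K e. {h \<in> holo_space W. \<forall>z\<in>K. dist (h z) (g z) < (e::real)}"
  have sub: "U n \<subseteq> holo_space W" for n using op openin_holo_topology by blast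
  obtain C where C: "\<And>n. compact (C n)" "\<And>n. C n \<subseteq> W" "\<And>n. C n \<subseteq> interior (C (Suc n))"
      "\<Union>(range C) = W" "\<And>K. \<lbrakk>compact K; K \<subseteq> W\<rbrakk> \<Longrightarrow> \<exists>N. \<forall>n\<ge>N. K \<subseteq> C n"
    using open_Union_compact_subsets[OF W] by metis
  have step: "\<exists>g' K' e'. g' \<in> holo_space W \<and> compact K' \<and> K' \<subseteq> W \<and> 0 < e' \<and>
      K \<union> C n \<subseteq> K' \<and> e' \<le> e / 2 \<and> (\<forall>z\<in>K. dist (g' z) (g z) < e / 2) \<and> ?N g' K' (2 * e') \<subseteq> U n"
    if gK: "g \<in> holo_space W" "compact K" "K \<subseteq> W" "0 < e" for g K e n
  proof -
    have "\<exists>h\<in>U n. \<forall>z\<in>K. dist (h z) (g z) < e / 2"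
      using iffD1[OF dense_in_holo_topology_iff[OF sub] dense[of n]] gK half_gt_zero[OF gK(4)] by blast
    then obtain g' where g': "g' \<in> U n" "\<forall>z\<in>K. dist (g' z) (g z) < e / 2" by blast
    obtain L d where L: "compact L" "L \<subseteq> W" "0 < d" "?N g' L d \<subseteq> U n"
      using op[of n] g'(1) unfolding openin_holo_topology by meson
    define K' e' where "K' = K \<union> C n \<union> L" and "e' = min (e/2) (d/2)"
    have "compact K'" "K' \<subseteq> W" "0 < e'" "K \<union> C n \<subseteq> K'" "e' \<le> e / 2"
      using gK L C(1,2)[of n] by (auto simp: K'_def e'_def)
    moreover have "2 * e' \<le> d" "L \<subseteq> K'" by (auto simp: K'_def e'_def)
    then have "?N g' K' (2 * e') \<subseteq> ?N g' L d" by (force intro: order.strict_trans2)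
    then have "?N g' K' (2 * e') \<subseteq> U n" using L(4) by (rule subset_trans)
    ultimately show ?thesis using g' sub by blast
  qed
  have "\<exists>h\<in>(\<Inter>n. U n). \<forall>z\<in>K. dist (h z) (g z) < e"
    if g: "g \<in> holo_space W" and K: "compact K" "K \<subseteq> W" and e: "e > 0" for g K and e :: real
  proof -
    \<comment> \<open>\<open>I\<close> says that a triple describes a neighbourhood, \<open>R\<close> that the second one refines the first.
      The closed neighbourhood of radius \<open>e'\<close> lies in the open one of radius \<open>2 * e'\<close>, so limits
      stay in \<open>U n\<close>.\<close>
    define I where "I = (\<lambda>(g, K, e). g \<in> holo_space W \<and> compact K \<and> K \<subseteq> W \<and> 0 < (e::real))"
    define R where "R = (\<lambda>n (g, K, e) (g', K', e'). K \<union> C n \<subseteq> K' \<and> e' \<le> e / 2 \<and>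
        (\<forall>z\<in>K. dist (g' z) (g z) < e / 2) \<and> ?N g' K' (2 * e') \<subseteq> U n)"
    have "\<exists>s. s 0 = (g, K, e) \<and> (\<forall>n. I (s n)) \<and> (\<forall>n. R n (s n) (s (Suc n)))"
    proof -
      have "\<exists>s. \<forall>n. (I (s n) \<and> (n = 0 \<longrightarrow> s n = (g, K, e))) \<and> R n (s n) (s (Suc n))"
      proof (rule dependent_nat_choice)
        show "\<exists>x. I x \<and> (0 = (0::nat) \<longrightarrow> x = (g, K, e))"
          using g K e by (auto simp: I_def)
        fix x and n :: nat assume x: "I x \<and> (n = 0 \<longrightarrow> x = (g, K, e))"
        obtain a b c where abc: "x = (a, b, c)" by (cases x) auto
        then have "I (a, b, c)" using x by blast
        then have "a \<in> holo_space W" "compact b" "b \<subseteq> W" "0 < c" by (simp_all add: I_def)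
        from step[OF this, of n] obtain g' K' e' where g': "g' \<in> holo_space W \<and> compact K' \<and> K' \<subseteq> W \<and> 0 < e' \<and>
          b \<union> C n \<subseteq> K' \<and> e' \<le> c / 2 \<and> (\<forall>z\<in>b. dist (g' z) (a z) < c / 2) \<and> ?N g' K' (2 * e') \<subseteq> U n"
          by blast
        then have "I (g', K', e')" "R n x (g', K', e')"
          unfolding I_def R_def abc prod.case by blast+
        then show "\<exists>y. (I y \<and> (Suc n = 0 \<longrightarrow> y = (g, K, e))) \<and> R n x y" by blast
      qed
      then show ?thesis by metis
    qed
    then obtain s where s: "s 0 = (g, K, e)" "\<And>n. I (s n)" "\<And>n. R n (s n) (s (Suc n))" by metis
    define G where "G n = fst (s n)" for n
    define L where "L n = fst (snd (s n))" for n
    define E where "E n = snd (snd (s n))" for n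
    have sn: "s n = (G n, L n, E n)" for n by (simp add: G_def L_def E_def)
    have G: "G n \<in> holo_space W" "compact (L n)" "L n \<subseteq> W" "0 < E n" for n
      using s(2)[of n] by (auto simp: sn I_def)
    have S: "L n \<union> C n \<subseteq> L (Suc n)" "E (Suc n) \<le> E n / 2"
        "\<And>z. z \<in> L n \<Longrightarrow> dist (G (Suc n) z) (G n z) < E n / 2" "?N (G (Suc n)) (L (Suc n)) (2 * E (Suc n)) \<subseteq> U n" for n
      using s(3)[of n] by (auto simp: sn R_def)
    have Lmono: "L m \<subseteq> L n" if "m \<le> n" for m n
    proof (rule lift_Suc_mono_le[OF _ that])
      show "L i \<subseteq> L (Suc i)" for i using S(1)[of i] by blast
    qed
    have tail: "dist (G (m + d) z) (G m z) \<le> E m - E (m + d)" if z: "z \<in> L m" for m d z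
    proof (induction d)
      case (Suc d)
      have "dist (G (Suc (m + d)) z) (G (m + d) z) < E (m + d) / 2"
        using S(3)[of z "m + d"] z Lmono[of m "m + d"] by auto
      then show ?case
        using Suc S(2)[of "m + d"] dist_triangle[of "G (Suc (m + d)) z" "G m z" "G (m + d) z"] by simp
    qed simp
    have Eto: "E n \<le> e * (1/2) ^ n" for n
    proof (induction n)
      case 0 then show ?case using s(1) sn[of 0] by simp
    next
      case (Suc n) then show ?case using S(2)[of n] by simp
    qed
    have dist_lim: "dist (G n z) (G m z) \<le> E m" if "m \<le> n" "z \<in> L m" for m n z
      using tail[OF that(2), of "n - m"] that(1) G(4)[of n] by simp
    have "uniformly_Cauchy_on X G" if X: "X \<subseteq> L m" for X m
    proof (rule uniformly_Cauchy_onI')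
      fix d :: real assume d: "0 < d"
      have "(\<lambda>n. e * (1/2) ^ n) \<longlonglongrightarrow> e * 0" by (intro tendsto_intros LIMSEQ_realpow_zero) auto
      then have "\<forall>\<^sub>F n in sequentially. e * (1/2) ^ n < d" using d by (intro order_tendstoD(2)[of _ "e * 0"]) auto
      then obtain M where M: "\<And>n. n \<ge> M \<Longrightarrow> e * (1/2) ^ n < d" by (auto simp: eventually_sequentially)
      show "\<exists>M. \<forall>x\<in>X. \<forall>a\<ge>M. \<forall>b>a. dist (G a x) (G b x) < d"
      proof (intro exI[of _ "max M m"] ballI allI impI)
        fix x a b assume "x \<in> X" "max M m \<le> a" "a < b"
        then have "dist (G b x) (G a x) \<le> E a" using X Lmono[of m a] by (intro dist_lim) auto
        also have "\<dots> < d" using Eto[of a] M[of a] \<open>max M m \<le> a\<close> by auto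
        finally show "dist (G a x) (G b x) < d" by (simp add: dist_commute)
      qed
    qed
    define h where "h = restrict (\<lambda>z. lim (\<lambda>n. G n z)) W"
    have lim: "uniform_limit X G h sequentially" if X: "X \<subseteq> L m" for X m
    proof -
      have "uniform_limit X G (\<lambda>z. lim (\<lambda>n. G n z)) sequentially"
        using Cauchy_uniformly_convergent[of X G] X \<open>\<And>X m. X \<subseteq> L m \<Longrightarrow> uniformly_Cauchy_on X G\<close>
        by (simp add: uniformly_convergent_uniform_limit_iff)
      moreover have "X \<subseteq> W" using X G(3) by blast
      ultimately show ?thesis
        by (subst uniform_limit_cong'[of X _ G _ "\<lambda>z. lim (\<lambda>n. G n z)"]) (auto simp: h_def)
    qed
    have "h holomorphic_on W"
    proof (rule holomorphic_uniform_sequence[OF W])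
      show "G n holomorphic_on W" for n using G(1) by (simp add: holo_space_def)
      fix x assume "x \<in> W"
      then obtain d where d: "0 < d" "cball x d \<subseteq> W" using W open_contains_cball by blast
      then obtain n where "cball x d \<subseteq> C n" using C(5)[of "cball x d"] by auto
      then have "cball x d \<subseteq> L (Suc n)" using S(1)[of n] by blast
      then show "\<exists>d>0. cball x d \<subseteq> W \<and> uniform_limit (cball x d) G h sequentially"
        using d lim by blast
    qed
    then have h: "h \<in> holo_space W" by (simp add: holo_space_def h_def)
    have hd: "dist (h z) (G m z) \<le> E m" if z: "z \<in> L m" for m z
    proof (rule tendsto_upperbound)
      show "(\<lambda>n. dist (G n z) (G m z)) \<longlonglongrightarrow> dist (h z) (G m z)"
        using tendsto_uniform_limitI[OF lim[OF order_refl] z] by (intro tendsto_intros)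
      show "\<forall>\<^sub>F n in sequentially. dist (G n z) (G m z) \<le> E m"
        using dist_lim[OF _ z] by (auto simp: eventually_sequentially)
    qed simp
    have "h \<in> U n" for n
    proof -
      have "dist (h z) (G (Suc n) z) < 2 * E (Suc n)" if "z \<in> L (Suc n)" for z
        using hd[OF that] G(4)[of "Suc n"] by linarith
      then show ?thesis using S(4)[of n] h by blast
    qed
    moreover have "dist (h z) (g z) < e" if z: "z \<in> K" for z
    proof -
      have e: "G 0 = g" "L 0 = K" "E 0 = e" using s(1) sn[of 0] by auto
      then have "dist (h z) (G 1 z) \<le> E 1" using hd[of z 1] Lmono[of 0 1] z by auto
      moreover have "dist (G 1 z) (g z) < e / 2" "E 1 \<le> e / 2" using S(3)[of z 0] S(2)[of 0] z e by auto
      ultimately show ?thesis using dist_triangle[of "h z" "g z" "G 1 z"] by linarith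
    qed
    ultimately show ?thesis by blast
  qed
  moreover have "(\<Inter>n. U n) \<subseteq> holo_space W" using sub by blast
  ultimately show ?thesis using dense_in_holo_topology_iff by metis
qed

section \<open>A countable dense set of entire functions\<close>

lemma entire_approx_poly:
  assumes "f holomorphic_on UNIV" and "0 < e"
  obtains p where "\<And>z. z \<in> cball 0 r \<Longrightarrow> norm (poly p z - f z) < e"
proof -
  define a where "a n = (deriv ^^ n) f 0 / fact n" for n
  define R where "R = of_real (\<bar>r\<bar> :: real) + (1::complex)"
  have R: "norm R = \<bar>r\<bar> + 1" unfolding R_def by (metis abs_ge_zero abs_of_nonneg add_nonneg_nonneg norm_of_real of_real_1 of_real_add zero_le_one)
  have sums: "(\<lambda>n. a n * w ^ n) sums f w" for w
    using holomorphic_power_series[of f 0 "norm w + 1" w] holomorphic_on_subset[OF assms(1)]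
    by (simp add: a_def)
  have abs_sum: "summable (\<lambda>n. norm (a n * (of_real \<bar>r\<bar>) ^ n))"
    using sums[of R] R by (intro powser_insidea[of _ R]) (auto simp: sums_iff)
  have "uniform_limit (cball 0 r) (\<lambda>n z. \<Sum>i<n. a i * z ^ i) (\<lambda>z. \<Sum>i. a i * z ^ i) sequentially"
  proof (rule Weierstrass_m_test[OF _ abs_sum])
    fix n and z :: complex assume "z \<in> cball 0 r"
    then have "norm z ^ n \<le> \<bar>r\<bar> ^ n" by (intro power_mono) auto
    then show "norm (a n * z ^ n) \<le> norm (a n * (of_real \<bar>r\<bar>) ^ n)"
      by (simp add: norm_mult norm_power mult_left_mono)
  qed
  then have "\<forall>\<^sub>F n in sequentially. \<forall>z\<in>cball 0 r. dist (\<Sum>i<n. a i * z ^ i) (\<Sum>i. a i * z ^ i) < e"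
    using assms(2) by (simp add: uniform_limit_iff)
  then obtain n where n: "\<forall>z\<in>cball 0 r. dist (\<Sum>i<n. a i * z ^ i) (\<Sum>i. a i * z ^ i) < e"
    using eventually_happens'[OF sequentially_bot] by blast
  show thesis
  proof (rule that[of "\<Sum>i<n. monom (a i) i"])
    fix z :: complex assume "z \<in> cball 0 r"
    then show "norm (poly (\<Sum>i<n. monom (a i) i) z - f z) < e"
      using n sums_unique[OF sums[of z]] by (simp add: poly_sum poly_monom dist_norm)
  qed
qed

lemma poly_approx_coeffs_in_dense_set:
  assumes D: "\<And>X :: complex set. open X \<Longrightarrow> X \<noteq> {} \<Longrightarrow> \<exists>d\<in>D. d \<in> X" and e: "0 < e"
  shows "\<exists>xs\<in>lists D. \<forall>z\<in>cball 0 r. norm (poly (Poly xs) z - poly p z) < e"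
  using e
proof (induction p arbitrary: e)
  case 0
  then show ?case by (intro bexI[of _ "[]"]) auto
next
  case (pCons a p)
  obtain d where d: "d \<in> D" "dist a d < e / 2" using D[of "ball a (e/2)"] pCons.prems by auto
  have "0 < e / 2 / (\<bar>r\<bar> + 1)" using pCons.prems by (simp add: add_nonneg_pos)
  from pCons.IH[OF this] obtain xs where xs: "xs \<in> lists D"
    "\<forall>z\<in>cball 0 r. norm (poly (Poly xs) z - poly p z) < e / 2 / (\<bar>r\<bar> + 1)" by blast
  have "norm (poly (Poly (d # xs)) z - poly (pCons a p) z) < e" if z: "z \<in> cball 0 r" for z
  proof -
    have "norm z * norm (poly (Poly xs) z - poly p z) \<le> (\<bar>r\<bar> + 1) * (e / 2 / (\<bar>r\<bar> + 1))"
      using z xs(2) by (intro mult_mono) (auto intro: less_imp_le)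
    also have "\<dots> = e / 2" by (simp add: field_simps)
    finally have "norm (z * (poly (Poly xs) z - poly p z)) \<le> e / 2" by (simp add: norm_mult)
    moreover have "norm (d - a) < e / 2" using d(2) by (simp add: dist_norm norm_minus_commute)
    moreover have eq: "poly (Poly (d # xs)) z - poly (pCons a p) z = (d - a) + z * (poly (Poly xs) z - poly p z)"
      by (simp add: algebra_simps)
    ultimately show ?thesis
      unfolding eq using norm_triangle_ineq[of "d - a" "z * (poly (Poly xs) z - poly p z)"] by linarith
  qed
  then show ?case using d xs by (intro bexI[of _ "d # xs"]) auto
qed

lemma countable_dense_polys:
  obtains Q :: "nat \<Rightarrow> complex poly"
  where "\<And>f e r. f holomorphic_on UNIV \<Longrightarrow> 0 < e \<Longrightarrow> \<exists>n. \<forall>z\<in>cball 0 r. norm (poly (Q n) z - f z) < e"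
proof -
  obtain D :: "complex set" where D: "countable D" "\<And>X. open X \<Longrightarrow> X \<noteq> {} \<Longrightarrow> \<exists>d\<in>D. d \<in> X"
    by (rule countable_dense_setE) blast
  have c: "countable (Poly ` lists D)" "Poly ` lists D \<noteq> {}" using D(1) by auto
  have "\<exists>n. \<forall>z\<in>cball 0 r. norm (poly (from_nat_into (Poly ` lists D) n) z - f z) < e"
    if f: "f holomorphic_on UNIV" and e: "0 < e" for f e r
  proof -
    obtain p where p: "\<And>z. z \<in> cball 0 r \<Longrightarrow> norm (poly p z - f z) < e / 2"
      using entire_approx_poly[OF f, of "e/2"] e by auto
    obtain xs where xs: "xs \<in> lists D" "\<forall>z\<in>cball 0 r. norm (poly (Poly xs) z - poly p z) < e / 2"
      using poly_approx_coeffs_in_dense_set[OF D(2), of "e/2"] e by (meson half_gt_zero)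
    obtain n where n: "from_nat_into (Poly ` lists D) n = Poly xs"
      using from_nat_into_surj[OF c(1)] xs(1) by (metis imageI)
    have "norm (poly (Poly xs) z - f z) < e" if "z \<in> cball 0 r" for z
      using norm_diff_triangle_less[OF bspec[OF xs(2) that] p[OF that]] by simp
    then show ?thesis by (intro exI[of _ n]) (simp add: n)
  qed
  then show thesis by (rule that)
qed

section \<open>Omitted values of iterates\<close>

text \<open>
  If \<open>f\<close> omits \<open>a\<close>, then \<open>f = a + exp \<circ> h\<close> with \<open>h\<close> entire. For \<open>v \<noteq> a\<close> the
  number \<open>v - a\<close> has infinitely many logarithms \<open>t j\<close>, and by the little Picard theorem \<open>h\<close> omits at
  most one of them. So \<open>v\<close> has a preimage other than \<open>a\<close>, and by induction preimages under all
  iterates.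
\<close>

lemma range_iterate_entire_omits_at_most_one:
  assumes f: "f holomorphic_on UNIV" and nonconst: "\<not> f constant_on UNIV"
  obtains a :: complex where "\<And>n. - {a} \<subseteq> range (f ^^ n)"
proof (cases "surj f")
  case True
  then have "surj (f ^^ n)" for n by (rule surj_fn)
  then show thesis using that by blast
next
  case False
  then obtain a where a: "\<And>z. f z \<noteq> a" by (auto simp: surj_def) metis
  have "simply_connected (UNIV :: complex set)" by (simp add: convex_imp_simply_connected)
  moreover have "(\<lambda>z. f z - a) holomorphic_on UNIV" by (intro holomorphic_intros f)
  ultimately obtain h where h: "h holomorphic_on UNIV" "\<And>z. f z - a = exp (h z)"
    using simply_connected_eq_holomorphic_log[OF open_UNIV] a by (metis (no_types, lifting) UNIV_I eq_iff_diff_eq_0)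
  have hit: "\<exists>z. z \<noteq> a \<and> f z = v" if v: "v \<noteq> a" for v
  proof (rule ccontr)
    assume no: "\<not> ?thesis"
    obtain u where u: "exp u = v - a" using v exp_Ln[of "v - a"] by (metis right_minus_eq)
    define t where "t j = u + 2 * of_nat j * of_real pi * \<i>" for j :: nat
    have inj: "t i = t j \<longleftrightarrow> i = j" for i j by (auto simp: t_def)
    have "exp (t j) = v - a" for j
      using exp_integer_2pi[of "of_nat j"] u by (simp add: t_def exp_add mult_ac)
    then have omit: "h z \<noteq> t j" if "z \<noteq> a" for z j
      using no that h(2)[of z] by (metis diff_add_cancel)
    \<comment> \<open>If \<open>v\<close> is attained at most at \<open>a\<close>, then \<open>h\<close> omits all \<open>t j\<close> except perhaps \<open>h a\<close>.\<close>
    obtain i j where ij: "i \<noteq> j" "h a \<noteq> t i" "h a \<noteq> t j"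
    proof -
      have "\<exists>k. \<forall>j. h a = t j \<longrightarrow> j = k" using inj by metis
      then obtain k where k: "\<And>j. j \<noteq> k \<Longrightarrow> h a \<noteq> t j" by blast
      show thesis by (rule that[of "Suc k" "Suc (Suc k)"]) (auto intro!: k)
    qed
    have "h z \<noteq> t i" "h z \<noteq> t j" for z using omit[of z] ij by (cases "z = a"; blast)+
    then have "range h \<inter> {t i, t j} = {}" by blast
    moreover have "t i \<noteq> t j" using ij inj by blast
    ultimately obtain c where "h = (\<lambda>x. c)" using little_Picard[OF h(1)] by blast
    then have "f z = a + exp c" for z using h(2)[of z] by (simp add: algebra_simps)
    then show False using nonconst by (auto simp: constant_on_def)
  qed
  have "- {a} \<subseteq> range (f ^^ n)" for n
  proof (induction n)
    case (Suc n)
    show ?case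
    proof
      fix v assume "v \<in> - {a}"
      then obtain z where "z \<in> - {a}" "f z = v" using hit by auto
      then obtain y where "v = (f ^^ Suc n) y" using Suc by auto
      then show "v \<in> range (f ^^ Suc n)" by blast
    qed
  qed simp
  then show thesis by (rule that)
qed

section \<open>Limit functions on the basin of a petal\<close>

text \<open>
  A single petal at the parabolic fixed point \<open>z0\<close>, with its Fatou coordinate \<open>\<phi>\<close> and the extension
  \<open>\<Phi>\<close> of \<open>\<phi>\<close> to the basin.
\<close>

locale petal_dynamics =
  fixes f :: "complex \<Rightarrow> complex" and z0 :: complex and P V :: "complex set"
    and \<phi> \<Phi> :: "complex \<Rightarrow> complex" and c :: real
  assumes f: "f holomorphic_on UNIV" and f_z0: "f z0 = z0"
    and openP: "open P" and f_P: "f ` P \<subseteq> P" and z0_P: "z0 \<notin> P"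
    and tendsto_z0: "\<And>z. z \<in> P \<Longrightarrow> (\<lambda>n. (f ^^ n) z) \<longlonglongrightarrow> z0"
    and half_plane: "{w. c < Re w} \<subseteq> V"
    and hol_\<phi>: "\<phi> holomorphic_on P" and bij_\<phi>: "bij_betw \<phi> P V"
    and hol_\<Phi>: "\<Phi> holomorphic_on petal_basin f P" and \<Phi>_P: "\<And>z. z \<in> P \<Longrightarrow> \<Phi> z = \<phi> z"
    and \<Phi>_f: "\<And>n z. z \<in> petal_basin f P \<Longrightarrow> \<Phi> ((f ^^ n) z) = \<Phi> z + of_nat n"
begin

abbreviation "G \<equiv> petal_basin f P"

definition "\<theta> = inv_into P \<phi>"

lemma inj_\<phi>: "inj_on \<phi> P"
  using bij_\<phi> by (rule bij_betw_imp_inj_on)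

lemma \<theta>_\<phi>: "z \<in> P \<Longrightarrow> \<theta> (\<phi> z) = z"
  unfolding \<theta>_def using inj_\<phi> by (rule inv_into_f_f)

lemma \<phi>_\<theta>: "w \<in> V \<Longrightarrow> \<phi> (\<theta> w) = w" and \<theta>_in: "w \<in> V \<Longrightarrow> \<theta> w \<in> P"
  using bij_\<phi> unfolding \<theta>_def
  by (auto simp: bij_betw_def f_inv_into_f inv_into_into)

lemma inj_\<theta>: "inj_on \<theta> V"
  by (metis \<phi>_\<theta> inj_onI)

lemma hol_\<theta>: "\<theta> holomorphic_on V"
proof -
  obtain g where g: "g holomorphic_on \<phi> ` P" "\<And>z. z \<in> P \<Longrightarrow> g (\<phi> z) = z"
    using holomorphic_has_inverse[OF hol_\<phi> openP inj_\<phi>] by metis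
  have "\<phi> ` P = V" using bij_\<phi> by (simp add: bij_betw_def)
  then show ?thesis
    using g \<phi>_\<theta> \<theta>_in by (metis holomorphic_transform)
qed

lemma iterate_P: "z \<in> P \<Longrightarrow> (f ^^ n) z \<in> P"
  by (induction n) (use f_P in auto)

lemma iterate_P_le:
  assumes "(f ^^ M) z \<in> P" "M \<le> n" shows "(f ^^ n) z \<in> P"
proof -
  have "(f ^^ (n - M + M)) z \<in> P"
    unfolding funpow_add o_apply using assms(1) by (rule iterate_P)
  then show ?thesis using assms(2) by simp
qed

lemma hol_iterate: "(f ^^ n) holomorphic_on UNIV"
proof (induction n)
  case (Suc n)
  then have "f \<circ> (f ^^ n) holomorphic_on UNIV"
    by (meson f holomorphic_on_compose holomorphic_on_subset subset_UNIV)
  then show ?case by (simp only: funpow.simps)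
qed (simp add: id_def)

lemma petal_basinI: "(f ^^ n) z \<in> P \<Longrightarrow> z \<in> G"
  unfolding petal_basin_def by blast

lemma iterate_ne_z0: "z \<in> G \<Longrightarrow> (f ^^ n) z \<noteq> z0"
proof
  assume "z \<in> G" and n: "(f ^^ n) z = z0"
  then obtain M where "(f ^^ M) z \<in> P" by (auto simp: petal_basin_def)
  then have "(f ^^ (n + M)) z \<in> P" by (rule iterate_P_le) simp
  moreover have "(f ^^ M) z0 = z0" by (induction M) (use f_z0 in auto)
  then have "(f ^^ (n + M)) z = z0" using n by (simp add: add.commute[of n] funpow_add)
  ultimately show False using z0_P by simp
qed

lemma open_iterate_vimage: "open ((f ^^ n) -` P)"
  by (intro open_vimage openP holomorphic_on_imp_continuous_on hol_iterate)

lemma openG: "open G"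
  unfolding petal_basin_def using open_iterate_vimage by blast

text \<open>
  This identity transfers the study of \<open>g \<circ> f ^^ n\<close> on \<open>G\<close> to that of the translates of \<open>g \<circ> \<theta>\<close>.
\<close>

lemma \<theta>_\<Phi>: "(f ^^ n) z \<in> P \<Longrightarrow> \<theta> (\<Phi> z + of_nat n) = (f ^^ n) z"
proof -
  assume z: "(f ^^ n) z \<in> P"
  then have "z \<in> G" by (auto simp: petal_basin_def)
  then have "\<phi> ((f ^^ n) z) = \<Phi> z + of_nat n" using \<Phi>_f \<Phi>_P[OF z] by simp
  then show ?thesis using \<theta>_\<phi>[OF z] by simp
qed

lemma \<Phi>_in_V: "(f ^^ n) z \<in> P \<Longrightarrow> \<Phi> z + of_nat n \<in> V"
proof -
  assume z: "(f ^^ n) z \<in> P"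
  then have "z \<in> G" by (auto simp: petal_basin_def)
  then have "\<phi> ((f ^^ n) z) = \<Phi> z + of_nat n" using \<Phi>_f \<Phi>_P[OF z] by simp
  then show ?thesis using z bij_\<phi> by (metis bij_betwE)
qed

lemma translate_in_V: "c < Re w + real n \<Longrightarrow> w + of_nat n \<in> V"
  using half_plane by auto

lemma f_\<theta>: "w \<in> V \<Longrightarrow> (f ^^ n) (\<theta> w) = \<theta> (w + of_nat n)"
  using \<theta>_\<Phi>[of n "\<theta> w"] iterate_P[of "\<theta> w" n] by (simp add: \<theta>_in \<Phi>_P \<phi>_\<theta>)

lemma nonconstant: "\<not> f constant_on UNIV"
proof
  assume "f constant_on UNIV"
  then have "f z = z0" for z using f_z0 by (metis UNIV_I constant_on_def)
  moreover have "\<theta> (of_real (c + 1)) \<in> P" using half_plane by (intro \<theta>_in) auto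
  ultimately show False using f_P z0_P by auto
qed

text \<open>
  The points \<open>\<theta> (w + n)\<close> and \<open>\<theta> (w + n + 1)\<close> are different, so one of them is not the value that the
  iterates of \<open>f\<close> may omit.
\<close>

lemma \<Phi>_surj: "\<Phi> ` G = UNIV"
proof -
  obtain a where a: "\<And>n. - {a} \<subseteq> range (f ^^ n)"
    using range_iterate_entire_omits_at_most_one[OF f nonconstant] by blast
  have "w \<in> \<Phi> ` G" for w
  proof -
    obtain N :: nat where N: "c - Re w < real N" using reals_Archimedean2 by blast
    have V: "w + of_nat N \<in> V" "w + of_nat (Suc N) \<in> V"
      using N by (auto intro!: translate_in_V simp del: of_nat_Suc)
    have "\<theta> (w + of_nat N) \<noteq> \<theta> (w + of_nat (Suc N))"
      using V inj_\<theta> by (metis add_left_cancel inj_onD n_not_Suc_n of_nat_eq_iff)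
    then obtain n where n: "w + of_nat n \<in> V" "\<theta> (w + of_nat n) \<noteq> a" using V by metis
    then obtain z where z: "(f ^^ n) z = \<theta> (w + of_nat n)"
      using a[of n] by (metis ComplI imageE singletonD subsetD)
    then have zG: "z \<in> G" using \<theta>_in[OF n(1)] by (intro petal_basinI[of n]) simp
    have "\<Phi> z + of_nat n = w + of_nat n"
      using \<Phi>_f[OF zG, of n] z \<Phi>_P[OF \<theta>_in[OF n(1)]] \<phi>_\<theta>[OF n(1)] by simp
    then show ?thesis using zG by auto
  qed
  then show ?thesis by auto
qed

lemma \<theta>_tendsto_z0: "(\<lambda>n. \<theta> (of_nat n)) \<longlonglongrightarrow> z0"
proof -
  obtain N :: nat where N: "c < real N" using reals_Archimedean2 by blast
  have V: "of_nat N \<in> V" using translate_in_V[of 0 N] N by simp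
  have "(\<lambda>n. \<theta> (of_nat (n + N))) \<longlonglongrightarrow> z0"
    using tendsto_z0[OF \<theta>_in[OF V]] by (simp add: f_\<theta>[OF V] add.commute)
  then show ?thesis by (rule LIMSEQ_offset)
qed

text \<open>
  Some translate of \<open>g \<circ> \<theta>\<close> by at least \<open>s\<close> is close to \<open>q\<close> on \<open>cball 0 s\<close>. The condition
  \<open>c + s < N\<close> puts the translated disc into \<open>V\<close>, and the uniform bound \<open>d\<close> makes the set open.
\<close>

definition universal_set :: "(complex \<Rightarrow> complex) \<Rightarrow> nat \<Rightarrow> (complex \<Rightarrow> complex) set" where
  "universal_set q s = {g \<in> holo_space (- {z0}). \<exists>N\<ge>s. c + real s < real N \<and>
     (\<exists>d<1 / Suc s. \<forall>w\<in>cball 0 (real s). norm (g (\<theta> (w + of_nat N)) - q w) \<le> d)}"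

lemma translated_disc_in_V:
  assumes "c + real s < real N" "norm w \<le> real s" shows "w + of_nat N \<in> V"
  using assms abs_Re_le_cmod[of w] by (intro translate_in_V) auto

lemma open_universal_set: "openin (holo_topology (- {z0})) (universal_set q s)"
  unfolding openin_holo_topology
proof (intro conjI ballI)
  fix g assume "g \<in> universal_set q s"
  then obtain N d where N: "N \<ge> s" "c + real s < real N" and d: "d < 1 / Suc s"
      "\<And>w. w \<in> cball 0 (real s) \<Longrightarrow> norm (g (\<theta> (w + of_nat N)) - q w) \<le> d"
    unfolding universal_set_def by blast
  define K where "K = (\<lambda>w. \<theta> (w + of_nat N)) ` cball 0 (real s)"
  have "continuous_on (cball 0 (real s)) (\<lambda>w. \<theta> (w + of_nat N))"
    using translated_disc_in_V[OF N(2)]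
    by (intro continuous_on_compose2[OF holomorphic_on_imp_continuous_on[OF hol_\<theta>]] continuous_intros) auto
  then have "compact K" unfolding K_def by (intro compact_continuous_image) auto
  moreover have "K \<subseteq> - {z0}"
    unfolding K_def using translated_disc_in_V[OF N(2)] \<theta>_in z0_P by fastforce
  moreover have "{h \<in> holo_space (- {z0}). \<forall>z\<in>K. dist (h z) (g z) < (1 / Suc s - d) / 2} \<subseteq> universal_set q s"
  proof
    fix h assume h: "h \<in> {h \<in> holo_space (- {z0}). \<forall>z\<in>K. dist (h z) (g z) < (1 / Suc s - d) / 2}"
    have "norm (h (\<theta> (w + of_nat N)) - q w) \<le> (1 / Suc s + d) / 2" if w: "w \<in> cball 0 (real s)" for w
    proof -
      have "dist (h (\<theta> (w + of_nat N))) (g (\<theta> (w + of_nat N))) < (1 / Suc s - d) / 2"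
        using h w by (auto simp: K_def)
      then have "norm (h (\<theta> (w + of_nat N)) - q w) \<le> (1 / Suc s - d) / 2 + d"
        using d(2)[OF w] unfolding dist_norm by (intro norm_diff_triangle_le) auto
      then show ?thesis by (simp add: field_simps)
    qed
    moreover have "(1 / Suc s + d) / 2 < 1 / Suc s" using d(1) by simp
    ultimately show "h \<in> universal_set q s"
      using h N unfolding universal_set_def by blast
  qed
  moreover have "(1 / Suc s - d) / 2 > 0" using d(1) by simp
  ultimately show "\<exists>K e. compact K \<and> K \<subseteq> - {z0} \<and> 0 < e \<and>
      {h \<in> holo_space (- {z0}). \<forall>z\<in>K. dist (h z) (g z) < e} \<subseteq> universal_set q s"
    by blast
qed (auto simp: universal_set_def)

text \<open>
  For large \<open>N\<close> the map \<open>w \<mapsto> \<theta> (w + N)\<close> is univalent on a disc of radius \<open>M = N - c\<close>, omits \<open>z0\<close>, and takes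
  \<open>0\<close> to a point near \<open>z0\<close>. So \<open>prescribe_on_univalent_disc\<close> applies to it.
\<close>

lemma dense_universal_set:
  assumes q: "q holomorphic_on UNIV"
  shows "holo_topology (- {z0}) closure_of (universal_set q s) = holo_space (- {z0})"
proof -
  have sub: "universal_set q s \<subseteq> holo_space (- {z0})" by (auto simp: universal_set_def)
  have approx: "\<exists>g\<in>universal_set q s. \<forall>z\<in>L. dist (g z) (g0 z) < \<epsilon>"
    if g0: "g0 \<in> holo_space (- {z0})" and L: "compact L" "L \<subseteq> - {z0}" and \<epsilon>: "0 < \<epsilon>" for g0 L \<epsilon>
  proof -
    define \<eta> where "\<eta> = 1 / real (Suc s)"
    define e where "e = min \<epsilon> (\<eta> / 4)"
    have "0 < \<eta>" by (simp add: \<eta>_def)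
    then have e: "0 < e" "e \<le> \<epsilon>" "2 * e < \<eta>" using \<epsilon> by (simp_all add: e_def min_def)
    obtain r where r: "0 < r" "\<And>z. z \<in> L \<Longrightarrow> r \<le> norm (z - z0)"
    proof -
      have "open (- L)" "z0 \<in> - L" using L by (auto simp: compact_imp_closed)
      then obtain r where "0 < r" "ball z0 r \<subseteq> - L" by (metis open_contains_ball)
      then have "r \<le> norm (z - z0)" if "z \<in> L" for z
        using that by (auto simp: subset_iff dist_norm norm_minus_commute not_less)
      then show thesis using that \<open>0 < r\<close> by blast
    qed
    have "uniformly_continuous_on (cball 0 (real s + 1)) q"
      using q by (intro compact_uniformly_continuous holomorphic_on_imp_continuous_on) (auto intro: holomorphic_on_subset)
    then obtain \<delta> where \<delta>: "0 < \<delta>" "\<And>w v. \<lbrakk>w \<in> cball 0 (real s + 1); v \<in> cball 0 (real s + 1); dist v w < \<delta>\<rbrakk> \<Longrightarrow> dist (q v) (q w) < e"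
      unfolding uniformly_continuous_on_def using e(1) by metis
    \<comment> \<open>If \<open>M\<close> is at least \<open>T\<close>, the deviation \<open>150 * s\<^sup>2 / M\<close> from an affine map is at most \<open>\<mu>\<close>, small
      enough for the uniform continuity of \<open>q\<close>.\<close>
    define \<mu> where "\<mu> = min (\<delta> / 2) 1"
    have \<mu>: "0 < \<mu>" "\<mu> \<le> \<delta> / 2" "\<mu> \<le> 1" using \<delta>(1) by (auto simp: \<mu>_def)
    define T where "T = max (1000 * real s) (150 * (real s)\<^sup>2 / \<mu>) + 1"
    have "\<forall>\<^sub>F n in sequentially. real n > T + c + real s + real s"
      using filterlim_real_sequentially unfolding filterlim_at_top_dense by blast
    moreover have "\<forall>\<^sub>F n in sequentially. dist (\<theta> (of_nat n)) z0 < r / 4"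
      by (rule tendstoD[OF \<theta>_tendsto_z0]) (use r(1) in simp)
    moreover have "\<forall>\<^sub>F n in sequentially. n \<ge> s" by (rule eventually_ge_at_top)
    ultimately have "\<forall>\<^sub>F n in sequentially. real n > T + c + real s + real s \<and> dist (\<theta> (of_nat n)) z0 < r / 4 \<and> n \<ge> s"
      by eventually_elim blast
    then obtain N where N: "real N > T + c + real s + real s" "dist (\<theta> (of_nat N)) z0 < r / 4" "N \<ge> s"
      using eventually_happens'[OF sequentially_bot] by blast
    define M where "M = real N - c"
    have T: "1 \<le> T" "1000 * real s \<le> T" by (auto simp: T_def le_max_iff_disj)
    have M: "0 < M" "1000 * real s \<le> M" "T \<le> M" "c + real s < real N"
      using N(1) T by (auto simp: M_def)
    have V: "w + of_nat N \<in> V" if "w \<in> ball 0 M" for w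
      using that abs_Re_le_cmod[of w] by (intro translate_in_V) (auto simp: M_def)
    define S where "S w = \<theta> (w + of_nat N)" for w
    have "\<exists>g\<in>holo_space (- {z0}). (\<forall>z\<in>L. dist (g z) (g0 z) < e) \<and>
           (\<forall>w\<in>cball 0 (real s). norm (g (S w) - q w) < 2 * e)"
    proof (rule prescribe_on_univalent_disc[where M = M])
      show "S holomorphic_on ball 0 M"
        unfolding S_def using V
        by (intro holomorphic_on_compose_gen[OF _ hol_\<theta>, unfolded o_def] holomorphic_intros) auto
      show "inj_on S (ball 0 M)"
      proof (rule inj_onI)
        fix x y assume "x \<in> ball 0 M" "y \<in> ball 0 M" "S x = S y"
        then have "x + of_nat N = y + of_nat N" using inj_onD[OF inj_\<theta>] V unfolding S_def by blast
        then show "x = y" by simp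
      qed
      show "z0 \<notin> S ` ball 0 M" using V \<theta>_in z0_P unfolding S_def by blast
      show "4 * norm (S 0 - z0) \<le> norm (z - z0)" if "z \<in> L" for z
        using r(2)[OF that] N(2) by (simp add: S_def dist_norm)
      show "g0 holomorphic_on - {z0}" using g0 by (simp add: holo_space_def)
      show "norm (q v - q w) < e" if w: "norm w \<le> real s" and v: "norm (v - w) \<le> 150 * (real s)\<^sup>2 / M" for w v
      proof -
        have "150 * (real s)\<^sup>2 / \<mu> \<le> M" using M(3) by (simp add: T_def)
        then have "150 * (real s)\<^sup>2 / M \<le> \<mu>" using M(1) \<mu>(1) by (simp add: divide_le_eq mult.commute)
        then have vw: "norm (v - w) \<le> \<delta> / 2" "norm (v - w) \<le> 1" using v \<mu> by linarith+
        then have "norm v \<le> real s + 1" using w norm_triangle_sub[of v w] by linarith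
        then show ?thesis using \<delta>(2)[of w v] \<delta>(1) w vw by (simp add: dist_norm)
      qed
    qed (use M q L e in auto)
    then obtain g where g: "g \<in> holo_space (- {z0})" "\<And>z. z \<in> L \<Longrightarrow> dist (g z) (g0 z) < e"
      "\<And>w. w \<in> cball 0 (real s) \<Longrightarrow> norm (g (\<theta> (w + of_nat N)) - q w) < 2 * e"
      unfolding S_def by blast
    have "g \<in> universal_set q s"
      unfolding universal_set_def using g N(3) M(4) e(3)[unfolded \<eta>_def]
      by (intro CollectI conjI exI[of _ N] exI[of _ "2 * e"] ballI) (auto intro: less_imp_le)
    moreover have "dist (g z) (g0 z) < \<epsilon>" if "z \<in> L" for z
      using g(2)[OF that] e(2) by linarith
    ultimately show ?thesis by blast
  qed
  show ?thesis
    unfolding dense_in_holo_topology_iff[OF sub] by (intro ballI allI impI approx)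
qed

text \<open>
  A limit function \<open>h\<close> takes equal values at points with equal \<open>\<Phi>\<close>, since large iterates of such
  points coincide; hence \<open>h = \<psi> \<circ> \<Phi>\<close>. As \<open>\<Phi>\<close> is open, the locally uniform convergence on \<open>G\<close> carries over
  to the translates of \<open>g \<circ> \<theta>\<close>, which converge to \<open>\<psi>\<close>.
\<close>

lemma omega_limit_subset:
  assumes g: "g holomorphic_on - {z0}"
  shows "omega_limit G g f \<subseteq> composition_space \<Phi> G"
proof
  fix h assume "h \<in> omega_limit G g f"
  then obtain n where hG: "h \<in> extensional G" and n: "strict_mono n"
      and lim: "locally_uniform_limit G (\<lambda>j. g \<circ> (f ^^ n j)) h sequentially"
    unfolding omega_limit_def by blast
  have n_ge: "\<forall>\<^sub>F j in sequentially. M \<le> n j" for M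
    using filterlim_subseq[OF n] by (simp add: filterlim_at_top)
  have pt: "(\<lambda>j. g ((f ^^ n j) z)) \<longlonglongrightarrow> h z" if z: "z \<in> G" for z
  proof -
    obtain U where "z \<in> U" "uniform_limit (U \<inter> G) (\<lambda>j. g \<circ> (f ^^ n j)) h sequentially"
      using lim z unfolding locally_uniform_limit_def by blast
    from tendsto_uniform_limitI[OF this(2), of z] this(1) z show ?thesis by simp
  qed
  define \<psi> where "\<psi> w = h (SOME z. z \<in> G \<and> \<Phi> z = w)" for w
  have lim_\<theta>: "(\<lambda>j. g (\<theta> (\<Phi> z + of_nat (n j)))) \<longlonglongrightarrow> h z" if z: "z \<in> G" for z
  proof -
    obtain M where M: "(f ^^ M) z \<in> P" using z by (auto simp: petal_basin_def)
    have "\<forall>\<^sub>F j in sequentially. g ((f ^^ n j) z) = g (\<theta> (\<Phi> z + of_nat (n j)))"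
      using n_ge[of M] by eventually_elim (simp add: \<theta>_\<Phi> iterate_P_le[OF M])
    then show ?thesis using pt[OF z] by (rule Lim_transform_eventually[rotated])
  qed
  have \<psi>_\<Phi>: "\<psi> (\<Phi> z) = h z" if z: "z \<in> G" for z
  proof -
    define y where "y = (SOME y. y \<in> G \<and> \<Phi> y = \<Phi> z)"
    have y: "y \<in> G" "\<Phi> y = \<Phi> z" unfolding y_def using someI[of "\<lambda>y. y \<in> G \<and> \<Phi> y = \<Phi> z" z] z by auto
    have "h y = h z" using lim_\<theta>[OF y(1)] lim_\<theta>[OF z] y(2) LIMSEQ_unique by metis
    then show ?thesis by (simp add: \<psi>_def y_def)
  qed
  have "\<exists>r>0. \<psi> holomorphic_on ball w r" for w
  proof -
    obtain z where z: "z \<in> G" "\<Phi> z = w" using \<Phi>_surj by (metis UNIV_I imageE)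
    obtain M where M: "(f ^^ M) z \<in> P" using z by (auto simp: petal_basin_def)
    obtain U where U: "open U" "z \<in> U" "uniform_limit (U \<inter> G) (\<lambda>j. g \<circ> (f ^^ n j)) h sequentially"
      using lim z unfolding locally_uniform_limit_def by blast
    define A where "A = U \<inter> (f ^^ M) -` P"
    have A: "open A" "z \<in> A" "A \<subseteq> U \<inter> G"
      using U M open_iterate_vimage by (auto simp: A_def petal_basin_def)
    have AP: "(f ^^ M) y \<in> P" if "y \<in> A" for y using that by (simp add: A_def)
    \<comment> \<open>On \<open>A\<close> the map \<open>\<Phi>\<close> is \<open>f ^^ M\<close> followed by \<open>\<phi>\<close> and a translation, all of them open maps.\<close>
    have opA: "open ((f ^^ M) ` A)"
    proof (rule open_mapping_thm[OF hol_iterate open_UNIV connected_UNIV A(1)])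
      show "\<not> (f ^^ M) constant_on UNIV"
      proof
        assume "(f ^^ M) constant_on UNIV"
        moreover have "(f ^^ M) z0 = z0" by (induction M) (use f_z0 in auto)
        ultimately have "(f ^^ M) z = z0" by (metis UNIV_I constant_on_def)
        then show False using iterate_ne_z0[OF z(1)] by blast
      qed
    qed simp
    have sub: "(f ^^ M) ` A \<subseteq> P" using AP by auto
    have "open (\<phi> ` ((f ^^ M) ` A))"
      by (rule open_mapping_thm3[OF holomorphic_on_subset[OF hol_\<phi> sub] opA inj_on_subset[OF inj_\<phi> sub]])
    then have "open ((\<lambda>w. w - of_nat M) ` \<phi> ` ((f ^^ M) ` A))" 
      using open_translation_subtract by blast
    moreover have "(\<lambda>w. w - of_nat M) ` \<phi> ` ((f ^^ M) ` A) = \<Phi> ` A"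
    proof -
      have "\<phi> ((f ^^ M) y) - of_nat M = \<Phi> y" if "y \<in> A" for y
        using \<Phi>_f[of y M] \<Phi>_P[OF AP[OF that]] A(3) that by auto
      then show ?thesis by (simp add: image_image)
    qed
    ultimately have "open (\<Phi> ` A)" by simp
    then obtain r where r: "0 < r" "cball w r \<subseteq> \<Phi> ` A"
      using A(2) z(2) by (metis image_eqI open_contains_cball)
    have hol: "\<forall>\<^sub>F j in sequentially. continuous_on (cball w r) (\<lambda>v. g (\<theta> (v + of_nat (n j)))) \<and>
        (\<lambda>v. g (\<theta> (v + of_nat (n j)))) holomorphic_on ball w r"
      using n_ge[of M]
    proof eventually_elim
      case (elim j)
      have V: "v + of_nat (n j) \<in> V" if "v \<in> cball w r" for v
        using that r(2) \<Phi>_in_V iterate_P_le[OF AP elim] by blast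
      have "(\<lambda>v. g (\<theta> (v + of_nat (n j)))) holomorphic_on cball w r"
      proof (rule holomorphic_on_compose_gen[OF _ g, unfolded o_def])
        show "(\<lambda>v. \<theta> (v + of_nat (n j))) holomorphic_on cball w r"
          using V by (intro holomorphic_on_compose_gen[OF _ hol_\<theta>, unfolded o_def] holomorphic_intros) auto
      qed (use V \<theta>_in z0_P in blast)
      then show ?case
        using holomorphic_on_imp_continuous_on holomorphic_on_subset[OF _ ball_subset_cball] by blast
    qed
    have "uniform_limit (cball w r) (\<lambda>j v. g (\<theta> (v + of_nat (n j)))) \<psi> sequentially"
      unfolding uniform_limit_iff
    proof (intro allI impI)
      fix e :: real assume "0 < e"
      then have "\<forall>\<^sub>F j in sequentially. \<forall>y\<in>U \<inter> G. dist ((g \<circ> (f ^^ n j)) y) (h y) < e"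
        using U(3) by (simp add: uniform_limit_iff)
      then show "\<forall>\<^sub>F j in sequentially. \<forall>v\<in>cball w r. dist (g (\<theta> (v + of_nat (n j)))) (\<psi> v) < e"
        using n_ge[of M]
      proof eventually_elim
        case (elim j)
        show ?case
        proof
          fix v assume "v \<in> cball w r"
          then obtain y where y: "y \<in> A" "v = \<Phi> y" using r(2) by auto
          then have "y \<in> U \<inter> G" using A(3) by blast
          then show "dist (g (\<theta> (v + of_nat (n j)))) (\<psi> v) < e"
            using elim(1) y \<psi>_\<Phi>[of y] \<theta>_\<Phi>[OF iterate_P_le[OF AP[OF y(1)] elim(2)]] by auto
        qed
      qed
    qed
    from holomorphic_uniform_limit[OF hol this] r(1) show ?thesis by auto
  qed
  then have "\<psi> holomorphic_on UNIV"
    by (metis UNIV_I analytic_imp_holomorphic analytic_on_def)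
  moreover have "h = restrict (\<psi> \<circ> \<Phi>) G"
    using hG \<psi>_\<Phi> by (auto simp: extensional_def restrict_def)
  ultimately show "h \<in> composition_space \<Phi> G"
    unfolding composition_space_def holo_space_def \<Phi>_surj by (auto intro!: exI[of _ \<psi>])
qed

text \<open>
  Approximate \<open>\<psi>\<close> on \<open>cball 0 j\<close> by some \<open>Q i\<close>, which a translate of \<open>g \<circ> \<theta>\<close> approximates in turn. The
  translation lengths can be made strictly increasing: membership in \<^const>\<open>universal_set\<close> for a larger
  \<open>s\<close> provides a longer translation, on a larger disc and with a smaller error.
\<close>

lemma composition_space_subset:
  fixes Q :: "nat \<Rightarrow> complex poly"
  assumes Q: "\<And>\<psi> e r. \<psi> holomorphic_on UNIV \<Longrightarrow> 0 < e \<Longrightarrow> \<exists>i. \<forall>z\<in>cball 0 r. norm (poly (Q i) z - \<psi> z) < e"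
    and g: "\<And>i s. g \<in> universal_set (poly (Q i)) s"
  shows "composition_space \<Phi> G \<subseteq> omega_limit G g f"
proof
  fix h assume "h \<in> composition_space \<Phi> G"
  then obtain \<psi> where h: "h = restrict (\<psi> \<circ> \<Phi>) G" and \<psi>: "\<psi> holomorphic_on UNIV"
    by (auto simp: composition_space_def holo_space_def \<Phi>_surj)
  have ex: "\<exists>N\<ge>s. \<forall>w\<in>cball 0 (real s). norm (g (\<theta> (w + of_nat N)) - \<psi> w) < 2 / Suc s" for s
  proof -
    obtain i where i: "\<forall>w\<in>cball 0 (real s). norm (poly (Q i) w - \<psi> w) < 1 / Suc s"
      using Q[OF \<psi>, of "1 / Suc s" "real s"] by auto
    obtain N d where N: "s \<le> N" "d < 1 / Suc s"
      "\<forall>w\<in>cball 0 (real s). norm (g (\<theta> (w + of_nat N)) - poly (Q i) w) \<le> d"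
      using g[of i s] unfolding universal_set_def by blast
    have "norm (g (\<theta> (w + of_nat N)) - \<psi> w) < 2 / Suc s" if w: "w \<in> cball 0 (real s)" for w
    proof -
      have "norm (g (\<theta> (w + of_nat N)) - poly (Q i) w) < 1 / Suc s" using N w by fastforce
      from norm_diff_triangle_less[OF this bspec[OF i w]] show ?thesis by simp
    qed
    then show ?thesis using N(1) by blast
  qed
  obtain n where n: "\<And>j. n j < n (Suc j)" "\<And>j. j < n j"
    "\<And>j w. w \<in> cball 0 (real j) \<Longrightarrow> norm (g (\<theta> (w + of_nat (n j))) - \<psi> w) < 2 / Suc j"
  proof -
    have "\<exists>n. \<forall>j. (j < n j \<and> (\<forall>w\<in>cball 0 (real j). norm (g (\<theta> (w + of_nat (n j))) - \<psi> w) < 2 / Suc j)) \<and> n j < n (Suc j)"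
    proof (rule dependent_nat_choice)
      have step: "\<exists>N>m. j < N \<and> (\<forall>w\<in>cball 0 (real j). norm (g (\<theta> (w + of_nat N)) - \<psi> w) < 2 / Suc j)" for m j
      proof -
        define s where "s = Suc (max m j)"
        obtain N where N: "s \<le> N" "\<forall>w\<in>cball 0 (real s). norm (g (\<theta> (w + of_nat N)) - \<psi> w) < 2 / Suc s"
          using ex by blast
        have "norm (g (\<theta> (w + of_nat N)) - \<psi> w) < 2 / Suc j" if "w \<in> cball 0 (real j)" for w
        proof -
          have "w \<in> cball 0 (real s)" using that by (auto simp: s_def)
          then have "norm (g (\<theta> (w + of_nat N)) - \<psi> w) < 2 / Suc s" using N(2) by blast
          also have "\<dots> \<le> 2 / Suc j" by (intro divide_left_mono) (auto simp: s_def)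
          finally show ?thesis .
        qed
        then show ?thesis using N(1) by (intro exI[of _ N]) (auto simp: s_def)
      qed
      show "\<exists>N. 0 < N \<and> (\<forall>w\<in>cball 0 (real 0). norm (g (\<theta> (w + of_nat N)) - \<psi> w) < 2 / Suc 0)"
        using step[of 0 0] by blast
      show "\<exists>N. (Suc j < N \<and> (\<forall>w\<in>cball 0 (real (Suc j)). norm (g (\<theta> (w + of_nat N)) - \<psi> w) < 2 / Suc (Suc j))) \<and> m < N" for m j
        using step[of m "Suc j"] by blast
    qed
    then show thesis using that by blast
  qed
  have "locally_uniform_limit G (\<lambda>j. g \<circ> (f ^^ n j)) h sequentially"
    unfolding locally_uniform_limit_def
  proof
    fix z assume z: "z \<in> G"
    then obtain M where M: "(f ^^ M) z \<in> P" by (auto simp: petal_basin_def)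
    define R where "R = norm (\<Phi> z) + 1"
    define U where "U = (G \<inter> \<Phi> -` ball 0 R) \<inter> (f ^^ M) -` P"
    have "open (G \<inter> \<Phi> -` ball 0 R)"
      using hol_\<Phi> openG by (intro continuous_open_preimage holomorphic_on_imp_continuous_on) auto
    then have U: "open U" "z \<in> U" using z M open_iterate_vimage by (auto simp: U_def R_def)
    have "uniform_limit (U \<inter> G) (\<lambda>j. g \<circ> (f ^^ n j)) h sequentially"
      unfolding uniform_limit_iff
    proof (intro allI impI)
      fix e :: real assume e: "0 < e"
      have "\<forall>\<^sub>F j in sequentially. R \<le> real j"
        using filterlim_real_sequentially by (simp add: filterlim_at_top)
      moreover have "(\<lambda>j. 2 / real (Suc j)) \<longlonglongrightarrow> 0"
        by (rule LIMSEQ_Suc[OF lim_const_over_n])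
      then have "\<forall>\<^sub>F j in sequentially. 2 / real (Suc j) < e" using e by (rule order_tendstoD)
      moreover have "\<forall>\<^sub>F j in sequentially. M \<le> j" by (rule eventually_ge_at_top)
      ultimately show "\<forall>\<^sub>F j in sequentially. \<forall>y\<in>U \<inter> G. dist ((g \<circ> (f ^^ n j)) y) (h y) < e"
      proof eventually_elim
        case (elim j)
        show ?case
        proof
          fix y assume y: "y \<in> U \<inter> G"
          then have "(f ^^ M) y \<in> P" by (simp add: U_def)
          then have "(f ^^ n j) y \<in> P" by (rule iterate_P_le) (use n(2)[of j] elim(3) in simp)
          then have "\<theta> (\<Phi> y + of_nat (n j)) = (f ^^ n j) y" by (rule \<theta>_\<Phi>)
          moreover have "\<Phi> y \<in> cball 0 (real j)" using y elim(1) by (auto simp: U_def)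
          ultimately have "norm (g ((f ^^ n j) y) - \<psi> (\<Phi> y)) < 2 / Suc j" using n(3) by metis
          then show "dist ((g \<circ> (f ^^ n j)) y) (h y) < e"
            using elim(2) y by (simp add: h dist_norm)
        qed
      qed
    qed
    then show "\<exists>U. open U \<and> z \<in> U \<and> uniform_limit (U \<inter> G) (\<lambda>j. g \<circ> (f ^^ n j)) h sequentially"
      using U by blast
  qed
  moreover have "strict_mono n" using n(1) by (simp add: strict_mono_Suc_iff)
  moreover have "\<forall>j. n j \<ge> 1" using n(2) by (metis One_nat_def Suc_leI gr0I not_less0)
  moreover have "h \<in> extensional G" by (simp add: h)
  ultimately show "h \<in> omega_limit G g f" unfolding omega_limit_def by blast
qed

theorem comeager_omega_limit:
  "comeager_in (holo_topology (- {z0}))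
     {g \<in> holo_space (- {z0}). omega_limit G g f = composition_space \<Phi> G}"
proof -
  obtain Q :: "nat \<Rightarrow> complex poly"
    where Q: "\<And>f e r. f holomorphic_on UNIV \<Longrightarrow> 0 < e \<Longrightarrow> \<exists>n. \<forall>z\<in>cball 0 r. norm (poly (Q n) z - f z) < e"
    using countable_dense_polys by blast
  define U where "U n = (case prod_decode n of (i, s) \<Rightarrow> universal_set (poly (Q i)) s)" for n
  have op: "openin (holo_topology (- {z0})) (U n)" for n
    by (simp add: U_def open_universal_set split: prod.split)
  have hol: "poly (Q i) holomorphic_on UNIV" for i by (intro holomorphic_intros)
  have dense: "holo_topology (- {z0}) closure_of U n = holo_space (- {z0})" for n
    by (simp add: U_def dense_universal_set[OF hol] split: prod.split)
  have "holo_topology (- {z0}) closure_of (\<Inter>n. U n) = holo_space (- {z0})"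
    by (rule Baire_holo_topology[OF open_Compl[OF closed_singleton] op dense])
  moreover have "gdelta_in (holo_topology (- {z0})) (\<Inter>n. U n)"
    using op by (intro gdelta_in_Inter) (auto intro: open_imp_gdelta_in)
  moreover have "(\<Inter>n. U n) \<subseteq> {g \<in> holo_space (- {z0}). omega_limit G g f = composition_space \<Phi> G}"
  proof
    fix g assume g: "g \<in> (\<Inter>n. U n)"
    have univ: "g \<in> universal_set (poly (Q i)) s" for i s
    proof -
      have "g \<in> U (prod_encode (i, s))" using g by blast
      then show ?thesis by (simp add: U_def)
    qed
    then have gh: "g \<in> holo_space (- {z0})" by (auto simp: universal_set_def)
    moreover have "omega_limit G g f \<subseteq> composition_space \<Phi> G"
      using gh by (intro omega_limit_subset) (simp add: holo_space_def)
    moreover have "composition_space \<Phi> G \<subseteq> omega_limit G g f"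
      using Q univ by (rule composition_space_subset)
    ultimately show "g \<in> {g \<in> holo_space (- {z0}). omega_limit G g f = composition_space \<Phi> G}" by blast
  qed
  ultimately show ?thesis unfolding comeager_in_def by auto
qed

end

theorem theorem4p8:
  fixes f \<phi> \<Phi> :: "complex \<Rightarrow> complex" and z0 :: complex and m k :: nat
    and P :: "nat \<Rightarrow> complex set" and V G :: "complex set"
  assumes "f holomorphic_on UNIV"
    and "\<not> (\<exists>p :: complex poly. degree p \<le> 1 \<and> f = poly p)"
    and "f z0 = z0"
    and "deriv f z0 = 1"
    and "m = (LEAST n. n \<ge> 1 \<and> (deriv ^^ (n + 1)) f z0 \<noteq> 0)"
    and "attracting_petals f z0 m P"
    and "k \<in> {1..m}"
    and "fatou_coordinate f (P k) V \<phi>"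
    and "G = petal_basin f (P k)"
    and "fatou_extension f (P k) \<phi> \<Phi>"
  shows "comeager_in (holo_topology (- {z0}))
           {g \<in> holo_space (- {z0}). omega_limit G g f = composition_space \<Phi> G}"
proof -
  have petal: "open (P k)" "f ` P k \<subseteq> P k" "z0 \<in> frontier (P k)"
      "uniform_limit (P k) (\<lambda>n. f ^^ n) (\<lambda>_. z0) sequentially"
    using assms(6,7) unfolding attracting_petals_def simply_connected_domain_def by auto
  obtain c where c: "{w. c < Re w} \<subseteq> V"
    using assms(8) unfolding fatou_coordinate_def by blast
  interpret petal_dynamics f z0 "P k" V \<phi> \<Phi> c
  proof
    show "z0 \<notin> P k" using petal(1,3) by (simp add: frontier_def interior_open)
    show "(\<lambda>n. (f ^^ n) z) \<longlonglongrightarrow> z0" if "z \<in> P k" for z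
      using tendsto_uniform_limitI[OF petal(4) that] by simp
    show "\<Phi> ((f ^^ n) z) = \<Phi> z + of_nat n" if "z \<in> petal_basin f (P k)" for n z
      using assms(10) that unfolding fatou_extension_def by (cases "n = 0") auto
  qed (use assms petal c in \<open>auto simp: fatou_coordinate_def conformal_map_def fatou_extension_def\<close>)
  show ?thesis using comeager_omega_limit assms(9) by simp
qed

end
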